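(* Let $n\geq 1$ and $d\geq 1$ be integers. The number of vertices of the polytope $\mathrm{sDist}(C^{(n)},\Delta_{\mathbb{Z}_d})$ of simplicial distributions on the $n$-cycle scenario with $d$ outcomes is $$V_{n,d}=\sum_{k=1}^{d}\binom{d}{k}^{n}(k!)^{n-1}(k-1)!.$$
   Context: For a set $U$, $D(U)$ is the set of functions $p:U\to\mathbb{R}_{\geq 0}$ with finite support and $\sum_{u\in U}p(u)=1$; for a function $f:U\to V$, $D(f):D(U)\to D(V)$ is the push-forward $D(f)(p)(v)=\sum_{u\in f^{-1}(v)}p(u)$. For a simplicial set $Y$, $D(Y)$ is the simplicial set with $D(Y)_n=D(Y_n)$ and structure maps $D(d_i)$, $D(s_j)$. A simplicial distribution on $(X,Y)$ is a simplicial map $p:X\to D(Y)$; the set of these is $\mathrm{sDist}(X,Y)$, which is convex under simplex-wise convex combinations. A vertex (extremal simplicial distribution) is a $p$ such that $p=\alpha q+(1-\alpha)\tilde q$ with $q,\tilde q\in \mathrm{sDist}(X,Y)$ and $0<\alpha\leq 1$ implies $p=q$. The $n$-circle $C^{(n)}$ is the $1$-dimensional simplicial set (a directed $n$-cycle) whose non-degenerate simplices are pairwise distinct $1$-simplices $\sigma_1,\dots,\sigma_n$ and pairwise distinct $0$-simplices $v_1,\dots,v_n$, with $d_1(\sigma_i)=v_i$, $d_0(\sigma_i)=d_1(\sigma_{i+1})$ for $1\leq i\leq n-1$, and $d_0(\sigma_n)=d_1(\sigma_1)$. $\mathbb{Z}_d=\{0,1,\dots,d-1\}$. For a set $U$,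 $\Delta_U$ is the simplicial set with $(\Delta_U)_n=U^{n+1}$, where $d_i$ deletes the coordinate $x_i$ of $(x_0,\dots,x_n)$ and $s_j$ repeats the coordinate $x_j$. The $n$-cycle scenario with $d$ outcomes is the pair $(C^{(n)},\Delta_{\mathbb{Z}_d})$. *)

theory Defs
  imports Complex_Main "HOL-Library.FuncSet"
begin

(* face X n i is the map d_i : X_n -> X_(n-1), relevant for 1 <= n and i <= n;
   degen X n j is the map s_j : X_n -> X_(n+1), relevant for j <= n. *)
record 'a sset =
  simplices :: "nat \<Rightarrow> 'a set"
  face :: "nat \<Rightarrow> nat \<Rightarrow> 'a \<Rightarrow> 'a"
  degen :: "nat \<Rightarrow> nat \<Rightarrow> 'a \<Rightarrow> 'a"

definition simplicial_set :: "'a sset \<Rightarrow> bool" where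
  "simplicial_set X \<longleftrightarrow>
    (\<forall>n i. i \<le> Suc n \<longrightarrow> face X (Suc n) i \<in> simplices X (Suc n) \<rightarrow> simplices X n) \<and>
    (\<forall>n j. j \<le> n \<longrightarrow> degen X n j \<in> simplices X n \<rightarrow> simplices X (Suc n)) \<and>
    (\<forall>n i j. \<forall>x \<in> simplices X (Suc (Suc n)). i < j \<and> j \<le> Suc (Suc n) \<longrightarrow>
       face X (Suc n) i (face X (Suc (Suc n)) j x) =
       face X (Suc n) (j - 1) (face X (Suc (Suc n)) i x)) \<and>
    (\<forall>n i j. \<forall>x \<in> simplices X n. i \<le> j \<and> j \<le> n \<longrightarrow>
       degen X (Suc n) i (degen X n j x) = degen X (Suc n) (Suc j) (degen X n i x)) \<and>
    (\<forall>n i j. \<forall>x \<in> simplices X (Suc n). i < j \<and> j \<le> Suc n \<longrightarrow>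
       face X (Suc (Suc n)) i (degen X (Suc n) j x) = degen X n (j - 1) (face X (Suc n) i x)) \<and>
    (\<forall>n j. \<forall>x \<in> simplices X n. j \<le> n \<longrightarrow>
       face X (Suc n) j (degen X n j x) = x \<and> face X (Suc n) (Suc j) (degen X n j x) = x) \<and>
    (\<forall>n i j. \<forall>x \<in> simplices X (Suc n). Suc j < i \<and> i \<le> Suc (Suc n) \<longrightarrow>
       face X (Suc (Suc n)) i (degen X (Suc n) j x) = degen X n j (face X (Suc n) (i - 1) x))"

definition nondegenerate :: "'a sset \<Rightarrow> nat \<Rightarrow> 'a set" where
  "nondegenerate X n = simplices X n -
     {degen X m j y | m j y. n = Suc m \<and> j \<le> m \<and> y \<in> simplices X m}"

(* Both X and Y are simplicial sets in all uses.  Maps are taken extensional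
   (undefined outside the simplices), so that equal simplicial maps are equal in HOL. *)
definition simplicial_maps :: "'a sset \<Rightarrow> 'b sset \<Rightarrow> (nat \<Rightarrow> 'a \<Rightarrow> 'b) set" where
  "simplicial_maps X Y =
    {f. (\<forall>n. f n \<in> simplices X n \<rightarrow>\<^sub>E simplices Y n) \<and>
        (\<forall>n i. \<forall>x \<in> simplices X (Suc n). i \<le> Suc n \<longrightarrow>
           f n (face X (Suc n) i x) = face Y (Suc n) i (f (Suc n) x)) \<and>
        (\<forall>n j. \<forall>x \<in> simplices X n. j \<le> n \<longrightarrow>
           f (Suc n) (degen X n j x) = degen Y n j (f n x))}"

(* A distribution on U is extended by 0 to the whole type. *)
definition dist_on :: "'u set \<Rightarrow> ('u \<Rightarrow> real) set" where
  "dist_on U = {p. (\<forall>u. 0 \<le> p u) \<and> (\<forall>u. u \<notin> U \<longrightarrow> p u = 0) \<and>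
                   finite {u. p u \<noteq> 0} \<and> (\<Sum>u | p u \<noteq> 0. p u) = 1}"

(* The fibre of f over v may be infinite, hence the restriction to the support of p. *)
definition push_forward :: "('u \<Rightarrow> 'v) \<Rightarrow> ('u \<Rightarrow> real) \<Rightarrow> 'v \<Rightarrow> real" where
  "push_forward f p = (\<lambda>v. \<Sum>u | p u \<noteq> 0 \<and> f u = v. p u)"

definition dist_sset :: "'b sset \<Rightarrow> ('b \<Rightarrow> real) sset" where
  "dist_sset Y = \<lparr>simplices = (\<lambda>n. dist_on (simplices Y n)),
                  face = (\<lambda>n i. push_forward (face Y n i)),
                  degen = (\<lambda>n j. push_forward (degen Y n j))\<rparr>"

definition sDist :: "'a sset \<Rightarrow> 'b sset \<Rightarrow> (nat \<Rightarrow> 'a \<Rightarrow> 'b \<Rightarrow> real) set" where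
  "sDist X Y = simplicial_maps X (dist_sset Y)"

definition convex_comb ::
  "'a sset \<Rightarrow> real \<Rightarrow> (nat \<Rightarrow> 'a \<Rightarrow> 'b \<Rightarrow> real) \<Rightarrow> (nat \<Rightarrow> 'a \<Rightarrow> 'b \<Rightarrow> real) \<Rightarrow> nat \<Rightarrow> 'a \<Rightarrow> 'b \<Rightarrow> real"
  where
  "convex_comb X \<alpha> q r =
     (\<lambda>n. \<lambda>x \<in> simplices X n. \<lambda>y. \<alpha> * q n x y + (1 - \<alpha>) * r n x y)"

definition sDist_vertices :: "'a sset \<Rightarrow> 'b sset \<Rightarrow> (nat \<Rightarrow> 'a \<Rightarrow> 'b \<Rightarrow> real) set" where
  "sDist_vertices X Y =
    {p \<in> sDist X Y. \<forall>q \<in> sDist X Y. \<forall>r \<in> sDist X Y. \<forall>\<alpha>.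
       0 < \<alpha> \<and> \<alpha> \<le> 1 \<and> p = convex_comb X \<alpha> q r \<longrightarrow> p = q}"

definition is_circle :: "nat \<Rightarrow> 'a sset \<Rightarrow> (nat \<Rightarrow> 'a) \<Rightarrow> (nat \<Rightarrow> 'a) \<Rightarrow> bool" where
  "is_circle n X \<sigma> v \<longleftrightarrow>
    simplicial_set X \<and>
    inj_on v {1..n} \<and> nondegenerate X 0 = v ` {1..n} \<and>
    inj_on \<sigma> {1..n} \<and> nondegenerate X 1 = \<sigma> ` {1..n} \<and>
    (\<forall>m \<ge> 2. nondegenerate X m = {}) \<and>
    (\<forall>i \<in> {1..n}. face X 1 1 (\<sigma> i) = v i) \<and>
    (\<forall>i \<in> {1..<n}. face X 1 0 (\<sigma> i) = face X 1 1 (\<sigma> (Suc i))) \<and>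
    face X 1 0 (\<sigma> n) = face X 1 1 (\<sigma> 1)"

(* (x_0, ..., x_n) is the list [x_0, ..., x_n]. *)
definition Delta :: "'u set \<Rightarrow> 'u list sset" where
  "Delta U = \<lparr>simplices = (\<lambda>n. {xs. length xs = Suc n \<and> set xs \<subseteq> U}),
              face = (\<lambda>n i xs. take i xs @ drop (Suc i) xs),
              degen = (\<lambda>n j xs. take (Suc j) xs @ drop j xs)\<rparr>"

abbreviation Z_mod :: "nat \<Rightarrow> nat set" where
  "Z_mod d \<equiv> {0..<d}"

(* A model of is_circle: the m-simplex (i, k), 1 <= k <= m + 1, is the pull-back of the i-th
   edge along the map [m] -> [1] that sends exactly 0, ..., k - 1 to 0.  The constant map to 1
   gives the end point of the edge, which is the vertex numbered circle_next n i. *)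
definition circle_next :: "nat \<Rightarrow> nat \<Rightarrow> nat" where
  "circle_next n i = (if i = n then 1 else Suc i)"

definition circle_model :: "nat \<Rightarrow> (nat \<times> nat) sset" where
  "circle_model n =
    \<lparr>simplices = (\<lambda>m. {1..n} \<times> {1..Suc m}),
     face = (\<lambda>m j (i, k). if j < k then (if k = 1 then (circle_next n i, m) else (i, k - 1))
                          else (i, k)),
     degen = (\<lambda>m j (i, k). if j < k then (i, Suc k) else (i, k))\<rparr>"

lemma circle_next_range: "1 \<le> n \<Longrightarrow> i \<in> {1..n} \<Longrightarrow> circle_next n i \<in> {1..n}"
  by (auto simp: circle_next_def)

lemma simplicial_set_circle_model:
  assumes "1 \<le> n"
  shows "simplicial_set (circle_model n)"
proof -
  have simplices: "simplices (circle_model n) m = {1..n} \<times> {1..Suc m}" for m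
    by (simp add: circle_model_def)
  have face: "face (circle_model n) m j (i, k) =
      (if j < k then (if k = 1 then (circle_next n i, m) else (i, k - 1)) else (i, k))" for m j i k
    by (simp add: circle_model_def)
  have degen: "degen (circle_model n) m j (i, k) = (if j < k then (i, Suc k) else (i, k))" for m j i k
    by (simp add: circle_model_def)
  note nxt = circle_next_range[OF assms, unfolded atLeastAtMost_iff]
  show ?thesis
    unfolding simplicial_set_def simplices
    apply (intro conjI allI impI ballI)
    subgoal using nxt by (auto simp: face)
    subgoal by (auto simp: degen)
    subgoal for m i j x by (cases x; cases j) (simp add: face; linarith)+
    subgoal for m i j x by (cases x) (simp add: degen)
    subgoal for m i j x by (cases x; cases j) (auto simp add: face degen)
    subgoal for m j x by (cases x) (auto simp add: face degen)
    subgoal for m j x by (cases x) (auto simp add: face degen)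
    subgoal for m i j x by (cases x; cases i) (auto simp add: face degen)
    done
qed

lemma is_circle_circle_model:
  assumes "1 \<le> n"
  shows "is_circle n (circle_model n) (\<lambda>i. (i, 1)) (\<lambda>i. (i, 1))"
proof -
  have 0: "nondegenerate (circle_model n) 0 = (\<lambda>i. (i, 1)) ` {1..n}"
    by (auto simp: nondegenerate_def circle_model_def)
  have 1: "nondegenerate (circle_model n) 1 = (\<lambda>i. (i, 1)) ` {1..n}"
  proof -
    have "(i, Suc (Suc 0)) \<in> {degen (circle_model n) m j y | m j y.
            1 = Suc m \<and> j \<le> m \<and> y \<in> simplices (circle_model n) m}" if "i \<in> {1..n}" for i
    proof -
      have "(i, Suc (Suc 0)) = degen (circle_model n) 0 0 (i, 1)" "(i, 1) \<in> simplices (circle_model n) 0"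
        using that by (auto simp: circle_model_def)
      then show ?thesis by (metis (mono_tags, lifting) One_nat_def le_refl mem_Collect_eq)
    qed
    moreover have "simplices (circle_model n) 1 = {1..n} \<times> {1, Suc (Suc 0)}"
      by (auto simp: circle_model_def)
    moreover have "(i, 1) \<notin> {degen (circle_model n) m j y | m j y.
            1 = Suc m \<and> j \<le> m \<and> y \<in> simplices (circle_model n) m}" for i
      by (auto simp: circle_model_def split: prod.splits if_splits)
    ultimately show ?thesis by (auto simp: nondegenerate_def)
  qed
  have "x \<notin> nondegenerate (circle_model n) m" if "2 \<le> m" for m x
  proof
    assume "x \<in> nondegenerate (circle_model n) m"
    moreover obtain l where l: "m = Suc l" "1 \<le> l" using \<open>2 \<le> m\<close> by (cases m) auto
    moreover obtain i k where x: "x = (i, k)" by (cases x)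
    ultimately have ik: "i \<in> {1..n}" "1 \<le> k" "k \<le> Suc (Suc l)"
      and nd: "\<And>j y. j \<le> l \<Longrightarrow> y \<in> {1..n} \<times> {1..Suc l} \<Longrightarrow> (i, k) \<noteq> degen (circle_model n) l j y"
      by (auto simp: nondegenerate_def circle_model_def)
    show False
    proof (cases "k = 1")
      case True
      then show False using nd[of l "(i, 1)"] ik l by (simp add: circle_model_def)
    next
      case False
      then obtain k' where "k = Suc k'" "1 \<le> k'" using ik by (cases k) auto
      then show False using nd[of 0 "(i, k')"] ik l by (simp add: circle_model_def)
    qed
  qed
  then have "\<forall>m\<ge>2. nondegenerate (circle_model n) m = {}" by blast
  then show ?thesis
    using assms simplicial_set_circle_model[OF assms] 0 1
    by (auto simp: is_circle_def inj_on_def circle_next_def) (auto simp: circle_model_def circle_next_def)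
qed

lemma face_Delta:
  assumes "length xs = Suc n" and "i \<le> n"
  shows "length (face (Delta U) n i xs) = n"
    and "k < n \<Longrightarrow> face (Delta U) n i xs ! k = xs ! (if k < i then k else Suc k)"
  using assms by (auto simp: Delta_def nth_append)

lemma degen_Delta:
  assumes "length xs = Suc n" and "j \<le> n"
  shows "length (degen (Delta U) n j xs) = Suc (Suc n)"
    and "k < Suc (Suc n) \<Longrightarrow> degen (Delta U) n j xs ! k = xs ! (if k \<le> j then k else k - 1)"
proof -
  show "length (degen (Delta U) n j xs) = Suc (Suc n)" using assms by (auto simp: Delta_def)
  assume "k < Suc (Suc n)"
  moreover have "length (take (Suc j) xs) = Suc j" using assms by simp
  moreover have "j + (k - Suc j) = k - 1" if "\<not> k \<le> j" using that by simp
  ultimately show "degen (Delta U) n j xs ! k = xs ! (if k \<le> j then k else k - 1)"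
    using assms by (auto simp: Delta_def nth_append simp del: take_Suc)
qed

lemma simplicial_set_Delta: "simplicial_set (Delta U)"
proof -
  have simplices: "simplices (Delta U) n = {xs. length xs = Suc n \<and> set xs \<subseteq> U}" for n
    by (simp add: Delta_def)
  have "set (face (Delta U) n i xs) \<subseteq> set xs" "set (degen (Delta U) n i xs) \<subseteq> set xs" for n i xs
    using set_take_subset set_drop_subset by (auto simp: Delta_def simp del: take_Suc drop_Suc) fast+
  then have closed: "set (face (Delta U) n i xs) \<subseteq> U" "set (degen (Delta U) n i xs) \<subseteq> U"
    if "set xs \<subseteq> U" for n i xs
    using that by (meson order_trans)+
  show ?thesis
    unfolding simplicial_set_def simplices
    apply (intro conjI allI impI ballI)
    subgoal by (simp add: face_Delta closed)
    subgoal by (simp add: degen_Delta closed)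
    subgoal for n i j x
      by (cases j; rule nth_equalityI) (auto simp: face_Delta less_Suc_eq_le)
    subgoal for n i j x
      by (rule nth_equalityI) (auto simp: degen_Delta)
    subgoal for n i j x
      by (cases j; rule nth_equalityI) (auto simp: face_Delta degen_Delta Suc_diff_le)
    subgoal for n j x
      by (rule nth_equalityI) (auto simp: face_Delta degen_Delta)
    subgoal for n j x
      by (rule nth_equalityI) (auto simp: face_Delta degen_Delta)
    subgoal for n i j x
      by (cases i; rule nth_equalityI) (auto simp: face_Delta degen_Delta)
    done
qed

lemma push_forward_eq_sum:
  assumes "finite {u. p u \<noteq> 0}"
  shows "push_forward f p v = (\<Sum>u | p u \<noteq> 0. if f u = v then p u else 0)"
  unfolding push_forward_def using assms
  by (subst sum.inter_filter[symmetric]) (auto intro: sum.cong)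

lemma push_forward_support:
  assumes "p \<in> dist_on U"
  shows "{v. push_forward f p v \<noteq> 0} = f ` {u. p u \<noteq> 0}"
proof -
  have fin: "finite {u. p u \<noteq> 0}" and nn: "\<And>u. 0 \<le> p u" using assms by (auto simp: dist_on_def)
  have "push_forward f p v = 0 \<longleftrightarrow> (\<forall>u \<in> {u. p u \<noteq> 0 \<and> f u = v}. p u = 0)" for v
    unfolding push_forward_def using fin nn by (intro sum_nonneg_eq_0_iff) auto
  then show ?thesis by blast
qed

lemma push_forward_sum:
  assumes "p \<in> dist_on U"
  shows "(\<Sum>v | push_forward f p v \<noteq> 0. if g v = w then push_forward f p v else 0) =
         (\<Sum>u | p u \<noteq> 0. if g (f u) = w then p u else 0)"
proof -
  have fin: "finite {u. p u \<noteq> 0}" using assms by (auto simp: dist_on_def)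
  have "(\<Sum>v | push_forward f p v \<noteq> 0. if g v = w then push_forward f p v else 0) =
        (\<Sum>v \<in> f ` {u. p u \<noteq> 0}. \<Sum>u \<in> {u \<in> {u. p u \<noteq> 0}. f u = v}. if g (f u) = w then p u else 0)"
    unfolding push_forward_support[OF assms]
    by (intro sum.cong refl) (auto simp: push_forward_def intro!: sum.cong)
  also have "\<dots> = (\<Sum>u | p u \<noteq> 0. if g (f u) = w then p u else 0)"
    by (rule sum.image_gen[OF fin, symmetric])
  finally show ?thesis .
qed

lemma push_forward_in_dist_on:
  assumes "p \<in> dist_on U" and "f \<in> U \<rightarrow> V"
  shows "push_forward f p \<in> dist_on V"
proof -
  have fin: "finite {u. p u \<noteq> 0}" and nn: "\<And>u. 0 \<le> p u"
    and su: "\<And>u. p u \<noteq> 0 \<Longrightarrow> u \<in> U" and one: "(\<Sum>u | p u \<noteq> 0. p u) = 1"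
    using assms by (auto simp: dist_on_def)
  have "0 \<le> push_forward f p v" for v unfolding push_forward_def by (intro sum_nonneg nn)
  moreover have "push_forward f p v = 0" if "v \<notin> V" for v
  proof (rule ccontr)
    assume "push_forward f p v \<noteq> 0"
    then have "v \<in> f ` {u. p u \<noteq> 0}" using push_forward_support[OF assms(1), of f] by blast
    then show False using su assms(2) that by blast
  qed
  moreover have "finite {v. push_forward f p v \<noteq> 0}"
    using push_forward_support[OF assms(1), of f] fin by simp
  moreover have "(\<Sum>v | push_forward f p v \<noteq> 0. push_forward f p v) = 1"
    using push_forward_sum[OF assms(1), of "\<lambda>_. ()" "()" f] one by simp
  ultimately show ?thesis by (simp add: dist_on_def)
qed

lemma push_forward_comp:
  assumes "p \<in> dist_on U"
  shows "push_forward g (push_forward f p) = push_forward (\<lambda>u. g (f u)) p"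
proof
  fix w
  have fin: "finite {u. p u \<noteq> 0}" using assms by (auto simp: dist_on_def)
  then have "finite {v. push_forward f p v \<noteq> 0}"
    using push_forward_support[OF assms, of f] by simp
  then show "push_forward g (push_forward f p) w = push_forward (\<lambda>u. g (f u)) p w"
    using push_forward_sum[OF assms] fin by (simp add: push_forward_eq_sum)
qed

lemma push_forward_cong:
  assumes "p \<in> dist_on U" and "\<And>u. u \<in> U \<Longrightarrow> f u = g u"
  shows "push_forward f p = push_forward g p"
proof
  fix v
  have "{u. p u \<noteq> 0 \<and> f u = v} = {u. p u \<noteq> 0 \<and> g u = v}"
    using assms by (simp add: dist_on_def) metis
  then show "push_forward f p v = push_forward g p v" by (simp add: push_forward_def)
qed

lemma push_forward_id:
  assumes "p \<in> dist_on U" and "\<And>u. u \<in> U \<Longrightarrow> f u = u"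
  shows "push_forward f p = p"
proof -
  have "push_forward (\<lambda>u. u) p = p"
  proof
    fix v
    have "{u. p u \<noteq> 0 \<and> u = v} = (if p v = 0 then {} else {v})" by auto
    then show "push_forward (\<lambda>u. u) p v = p v" by (simp add: push_forward_def)
  qed
  then show ?thesis using push_forward_cong[OF assms(1), of f "\<lambda>u. u"] assms(2) by simp
qed

lemma simplicial_set_dist_sset:
  assumes "simplicial_set Y"
  shows "simplicial_set (dist_sset Y)"
  using assms unfolding simplicial_set_def dist_sset_def
  by (auto intro!: push_forward_in_dist_on push_forward_cong push_forward_id
      simp: push_forward_comp Pi_iff)

end

theory Submission
  imports Defs
begin

text \<open>
  A simplicial distribution on the circle is determined by the distributions on \<open>\<int>\<^sub>d \<times> \<int>\<^sub>d\<close> that it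
  assigns to the edges, and the face identities say that consecutive edges have equal marginals. So
  it is a circulation on the digraph with nodes \<open>(i, a)\<close>, where the layer \<open>i\<close> is taken modulo \<open>n\<close>, and
  edges from \<open>(i, a)\<close> to \<open>(i + 1, b)\<close>, with total flow 1 through each layer. The support of a
  circulation contains a simple cycle, a small multiple of which can be split off; therefore the
  vertices are the normalised simple cycles. A cycle that winds around \<open>k\<close> times together with one of
  its \<open>k\<close> nodes in layer 0 is the same thing as a choice of \<open>k\<close> distinct outcomes in order in each
  layer, which gives \<open>((d choose k) * k!) ^ n / k\<close> cycles.
\<close>

section \<open>Circulations and simple cycles\<close>

text \<open>The hypothesis \<open>is_circle\<close> speaks of nondegenerate simplices only, whereas
  a simplicial distribution has values in every dimension. The bridge is
  \<open>circle_model\<close>: every simplex of the circle, vertices included, is the pull-back of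
  an edge along a monotone map to [1], so its value is a push-forward of an edge distribution, and a
  genuine condition arises only at the face that passes from one edge to the next. That degenerate
  simplices are pairwise distinct has to be extracted from the simplicial identities.

  On the combinatorial side every edge of the digraph advances one layer, so the length of a closed
  walk is a multiple of n. A starting point and a time index make the layers independent of each
  other, which is what can be counted. That a simple cycle is a vertex rests on each of its nodes
  having a single incoming and a single outgoing edge in the support: conservation then leaves one
  free constant, and total flow 1 fixes it.\<close>

text \<open>A walk of length \<open>n * k\<close> winding \<open>k\<close> times around the layers, extended periodically and with a
  chosen starting point; at time \<open>t\<close> it is in layer \<open>t mod n\<close>, and the last condition says that it
  is a simple cycle.\<close>

definition cyclic_walks :: "nat \<Rightarrow> nat \<Rightarrow> nat \<Rightarrow> (nat \<Rightarrow> nat) set" where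
  "cyclic_walks n d k = {s. (\<forall>t. s t < d) \<and> (\<forall>t. s (t + n * k) = s t) \<and>
     (\<forall>t t'. t mod n = t' mod n \<and> s t = s t' \<longrightarrow> t mod (n * k) = t' mod (n * k))}"

text \<open>The cycle has \<open>k\<close> edges in each layer, so the weight
  \<open>1 / real k\<close> gives total flow 1. Only the set of traversed edges enters, so the
  choice of starting point is forgotten.\<close>

definition walk_flow :: "nat \<Rightarrow> nat \<Rightarrow> (nat \<Rightarrow> nat) \<Rightarrow> nat \<Rightarrow> nat \<Rightarrow> nat \<Rightarrow> real" where
  "walk_flow n k s i a b =
     (if \<exists>t. t mod n = i \<and> s t = a \<and> s (Suc t) = b then 1 / real k else 0)"

text \<open>\<open>P i a b\<close> is the probability of the outcome \<open>(a, b)\<close> on the edge \<open>\<sigma> (Suc i)\<close>: edges are counted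
  from 0 here, so that the successor of an edge is \<open>Suc i mod n\<close>.\<close>

definition flows :: "nat \<Rightarrow> nat \<Rightarrow> (nat \<Rightarrow> nat \<Rightarrow> nat \<Rightarrow> real) set" where
  "flows n d = {P. (\<forall>i a b. 0 \<le> P i a b) \<and>
     (\<forall>i a b. \<not> (i < n \<and> a < d \<and> b < d) \<longrightarrow> P i a b = 0) \<and>
     (\<forall>i<n. (\<Sum>a<d. \<Sum>b<d. P i a b) = 1) \<and>
     (\<forall>i<n. \<forall>b<d. (\<Sum>a<d. P i a b) = (\<Sum>c<d. P (Suc i mod n) b c))}"

definition extremal_flows :: "nat \<Rightarrow> nat \<Rightarrow> (nat \<Rightarrow> nat \<Rightarrow> nat \<Rightarrow> real) set" where
  "extremal_flows n d = {P \<in> flows n d. \<forall>Q \<in> flows n d. \<forall>R \<in> flows n d. \<forall>\<alpha>.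
     0 < \<alpha> \<and> \<alpha> \<le> 1 \<and> P = (\<lambda>i a b. \<alpha> * Q i a b + (1 - \<alpha>) * R i a b) \<longrightarrow> P = Q}"

section \<open>Periodicity of simple closed walks\<close>

lemma walk_flow_nonzero_iff:
  "0 < k \<Longrightarrow> walk_flow n k s i a b \<noteq> 0 \<longleftrightarrow> (\<exists>t. t mod n = i \<and> s t = a \<and> s (Suc t) = b)"
  by (simp add: walk_flow_def)

lemma cyclic_walks_less: "s \<in> cyclic_walks n d k \<Longrightarrow> s t < d"
  by (simp add: cyclic_walks_def)

lemma cyclic_walks_cong:
  assumes s: "s \<in> cyclic_walks n d k" and "t mod (n * k) = t' mod (n * k)"
  shows "s t = s t'"
proof -
  have per: "s (t + m * (n * k)) = s t" for t m
  proof (induction m)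
    case (Suc m)
    have "s (t + Suc m * (n * k)) = s (t + m * (n * k) + n * k)" by (simp add: algebra_simps)
    also have "\<dots> = s (t + m * (n * k))" using s by (simp only: cyclic_walks_def mem_Collect_eq)
    finally show ?case using Suc by simp
  qed simp
  have "s t = s (t mod (n * k))" for t
    using per[of "t mod (n * k)" "t div (n * k)"] by (simp only: mod_div_mult_eq)
  then show ?thesis using assms(2) by metis
qed

lemma cyclic_walks_inj:
  "s \<in> cyclic_walks n d k \<Longrightarrow> t mod n = t' mod n \<Longrightarrow> s t = s t' \<Longrightarrow> t mod (n * k) = t' mod (n * k)"
  unfolding cyclic_walks_def by blast

lemma mod_Suc_cong: "(t::nat) mod m = t' mod m \<Longrightarrow> Suc t mod m = Suc t' mod m"
  by (metis mod_Suc_eq)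

lemma mod_Suc_cancel:
  assumes "0 < m" and "Suc t mod m = Suc t' mod m"
  shows "(t::nat) mod m = t' mod m"
proof -
  have "(Suc t + (m - 1)) mod m = (Suc t' + (m - 1)) mod m" using assms(2) by (rule mod_add_cong) simp
  then show ?thesis using assms(1) by simp
qed

text \<open>Equal nodes sit at the same position of the period, so the continuation is the same: a
  visited node has one outgoing edge, and by the next lemma one incoming edge.\<close>

lemma cyclic_walks_next:
  assumes "s \<in> cyclic_walks n d k" "t mod n = t' mod n" "s t = s t'"
  shows "s (Suc t) = s (Suc t')"
  by (rule cyclic_walks_cong[OF assms(1)], rule mod_Suc_cong, rule cyclic_walks_inj[OF assms])

lemma cyclic_walks_prev:
  assumes "s \<in> cyclic_walks n d k" "0 < n" "0 < k" "t mod n = t' mod n" "s (Suc t) = s (Suc t')"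
  shows "s t = s t'"
proof -
  have "Suc t mod (n * k) = Suc t' mod (n * k)"
    by (rule cyclic_walks_inj[OF assms(1) mod_Suc_cong[OF assms(4)] assms(5)])
  moreover have "0 < n * k" using assms(2,3) by simp
  ultimately have "t mod (n * k) = t' mod (n * k)" by (metis mod_Suc_cancel)
  then show ?thesis by (rule cyclic_walks_cong[OF assms(1)])
qed

lemma cyclic_walks_visit_Suc:
  assumes "s \<in> cyclic_walks n d k" "0 < n" "0 < k" "i < n"
  shows "(\<exists>t. t mod n = i \<and> s (Suc t) = b) \<longleftrightarrow> (\<exists>t. t mod n = Suc i mod n \<and> s t = b)" (is "?L \<longleftrightarrow> ?R")
proof
  assume ?L
  then show ?R by (metis mod_Suc_eq)
next
  assume ?R
  then obtain t where t: "t mod n = Suc i mod n" "s t = b" by auto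
  \<comment> \<open>A full period is added before stepping back, because \<open>t\<close> may be
    0.\<close>
  define t' where "t' = t + n * k - 1"
  have S: "Suc t' = t + n * k" using assms by (simp add: t'_def)
  then have "Suc t' mod n = Suc i mod n" using t by simp
  then have "t' mod n = i" using mod_Suc_cancel[of n t' i] assms by simp
  moreover have "s (Suc t') = b" unfolding S using t assms(1) by (simp add: cyclic_walks_def)
  ultimately show ?L by blast
qed

section \<open>Walk flows are circulations\<close>

lemma sum_if_unique:
  fixes c :: real
  assumes "finite A" and "\<And>x. Q x \<Longrightarrow> x \<in> A" and "\<And>x y. Q x \<Longrightarrow> Q y \<Longrightarrow> x = y"
  shows "(\<Sum>x\<in>A. if Q x then c else 0) = (if \<exists>x. Q x then c else 0)"
proof (cases "\<exists>x. Q x")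
  case True
  then obtain x where x: "Q x" by auto
  have "(\<Sum>y\<in>A. if Q y then c else 0) = (\<Sum>y\<in>A. if y = x then c else 0)"
    by (intro sum.cong refl) (metis assms(3) x)
  then show ?thesis using assms x by auto
qed simp

lemma walk_flow_out:
  assumes "s \<in> cyclic_walks n d k"
  shows "(\<Sum>b<d. walk_flow n k s i a b) = (if \<exists>t. t mod n = i \<and> s t = a then 1 / real k else 0)"
proof -
  let ?Q = "\<lambda>b. \<exists>t. t mod n = i \<and> s t = a \<and> s (Suc t) = b"
  have "(\<Sum>b<d. if ?Q b then 1 / real k else 0) = (if \<exists>b. ?Q b then 1 / real k else 0)"
  proof (rule sum_if_unique)
    show "x = y" if "?Q x" "?Q y" for x y using that cyclic_walks_next[OF assms] by metis
  qed (use cyclic_walks_less[OF assms] in auto)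
  moreover have "(\<exists>b. ?Q b) \<longleftrightarrow> (\<exists>t. t mod n = i \<and> s t = a)" by blast
  ultimately show ?thesis by (simp only: walk_flow_def)
qed

lemma walk_flow_in:
  assumes "s \<in> cyclic_walks n d k" "0 < n" "0 < k"
  shows "(\<Sum>a<d. walk_flow n k s i a b) = (if \<exists>t. t mod n = i \<and> s (Suc t) = b then 1 / real k else 0)"
proof -
  let ?Q = "\<lambda>a. \<exists>t. t mod n = i \<and> s t = a \<and> s (Suc t) = b"
  have "(\<Sum>a<d. if ?Q a then 1 / real k else 0) = (if \<exists>a. ?Q a then 1 / real k else 0)"
  proof (rule sum_if_unique)
    show "x = y" if "?Q x" "?Q y" for x y using that cyclic_walks_prev[OF assms] by metis
  qed (use cyclic_walks_less[OF assms(1)] in auto)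
  moreover have "(\<exists>a. ?Q a) \<longleftrightarrow> (\<exists>t. t mod n = i \<and> s (Suc t) = b)" by blast
  ultimately show ?thesis by (simp only: walk_flow_def)
qed

text \<open>Within one period layer \<open>i\<close> is visited at the times
  \<open>i + n * j\<close> with \<open>j < k\<close>, and simplicity makes the nodes found there
  distinct.\<close>

lemma card_cyclic_walks_layer:
  assumes s: "s \<in> cyclic_walks n d k" and "0 < n" "0 < k" "i < n"
  shows "card {a. \<exists>t. t mod n = i \<and> s t = a} = k"
proof -
  have "{a. \<exists>t. t mod n = i \<and> s t = a} = (\<lambda>j. s (i + n * j)) ` {..<k}"
  proof (intro equalityI subsetI)
    fix a assume "a \<in> {a. \<exists>t. t mod n = i \<and> s t = a}"
    then obtain t where t: "t mod n = i" "s t = a" by auto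
    have "t mod (n * k) = i + n * (t div n mod k)" using t by (simp add: mod_mult2_eq)
    then have "s (i + n * (t div n mod k)) = a" using t cyclic_walks_cong[OF s] by (metis mod_mod_trivial)
    then show "a \<in> (\<lambda>j. s (i + n * j)) ` {..<k}" using \<open>0 < k\<close> by force
  next
    fix a assume "a \<in> (\<lambda>j. s (i + n * j)) ` {..<k}"
    then obtain j where "s (i + n * j) = a" by auto
    moreover have "(i + n * j) mod n = i" using \<open>i < n\<close> by simp
    ultimately show "a \<in> {a. \<exists>t. t mod n = i \<and> s t = a}" by blast
  qed
  moreover have "inj_on (\<lambda>j. s (i + n * j)) {..<k}"
  proof (rule inj_onI)
    fix j j' assume j: "j \<in> {..<k}" "j' \<in> {..<k}" "s (i + n * j) = s (i + n * j')"
    then have "(i + n * j) mod (n * k) = (i + n * j') mod (n * k)"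
      by (intro cyclic_walks_inj[OF s]) auto
    then show "j = j'" using j assms by (simp add: mod_mult2_eq)
  qed
  ultimately show ?thesis by (simp add: card_image)
qed

lemma cyclic_walks_length_le:
  assumes "s \<in> cyclic_walks n d k" "0 < n" "0 < k"
  shows "k \<le> d"
proof -
  have "{a. \<exists>t. t mod n = 0 \<and> s t = a} \<subseteq> {..<d}" using assms cyclic_walks_less by auto
  then show ?thesis using card_cyclic_walks_layer[OF assms assms(2)] card_mono[OF finite_lessThan] by fastforce
qed

lemma walk_flow_in_flows:
  assumes s: "s \<in> cyclic_walks n d k" and n: "0 < n" and k: "0 < k"
  shows "walk_flow n k s \<in> flows n d"
proof -
  have "(\<Sum>a<d. \<Sum>b<d. walk_flow n k s i a b) = 1" if "i < n" for i
  proof -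
    let ?A = "{a. \<exists>t. t mod n = i \<and> s t = a}"
    have "?A \<subseteq> {..<d}" using s cyclic_walks_less by auto
    then have "(\<Sum>a<d. if \<exists>t. t mod n = i \<and> s t = a then 1 / real k else 0) = (\<Sum>a\<in>?A. 1 / real k)"
      by (intro sum.mono_neutral_cong_right) auto
    then show ?thesis
      using card_cyclic_walks_layer[OF assms that] k by (simp add: walk_flow_out[OF s])
  qed
  moreover have "(\<Sum>a<d. walk_flow n k s i a b) = (\<Sum>c<d. walk_flow n k s (Suc i mod n) b c)" if "i < n" for i b
    unfolding walk_flow_out[OF s] walk_flow_in[OF assms] using cyclic_walks_visit_Suc[OF assms that] by simp
  moreover have "walk_flow n k s i a b = 0" if "\<not> (i < n \<and> a < d \<and> b < d)" for i a b
    using that s n cyclic_walks_less[OF s] by (auto simp: walk_flow_def)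
  ultimately show ?thesis by (simp add: flows_def) (simp add: walk_flow_def)
qed

section \<open>Extremal circulations are the walk flows\<close>

text \<open>Nonnegativity and \<alpha> > 0 confine \<open>Q\<close> to the edges of the cycle. There
  conservation forces equal values on consecutive edges, so \<open>Q\<close> is a multiple of the
  walk flow, and both have total flow 1.\<close>

lemma extremal_walk_flow:
  assumes s: "s \<in> cyclic_walks n d k" and n: "0 < n" and k: "0 < k"
  shows "walk_flow n k s \<in> extremal_flows n d"
proof -
  let ?f = "walk_flow n k s"
  have "?f = Q" if Q: "Q \<in> flows n d" and R: "R \<in> flows n d" and \<alpha>: "0 < \<alpha>" "\<alpha> \<le> 1"
    and eq: "?f = (\<lambda>i a b. \<alpha> * Q i a b + (1 - \<alpha>) * R i a b)" for Q R \<alpha>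
  proof -
    have Q0: "0 \<le> Q i a b" and R0: "0 \<le> R i a b" for i a b using Q R by (auto simp: flows_def)
    have off: "Q i a b = 0" if "?f i a b = 0" for i a b
    proof -
      have "0 \<le> \<alpha> * Q i a b" "0 \<le> (1 - \<alpha>) * R i a b" using \<alpha> Q0 R0 by simp_all
      moreover have "\<alpha> * Q i a b + (1 - \<alpha>) * R i a b = 0"
        using that fun_cong[OF fun_cong[OF fun_cong[OF eq]], of i a b] by simp
      ultimately have "\<alpha> * Q i a b = 0" by linarith
      then show ?thesis using \<alpha> by simp
    qed
    \<comment> \<open>The value of \<open>Q\<close> on the edge used at time \<open>t\<close>. As
      \<open>Q\<close> vanishes off the cycle, it is the whole outflow of the node at time
      \<open>t\<close> and also the whole inflow of the node at time \<open>Suc t\<close>.\<close>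
    define c where "c t = Q (t mod n) (s t) (s (Suc t))" for t
    have out: "(\<Sum>b<d. Q (t mod n) (s t) b) = c t" for t
    proof -
      have "Q (t mod n) (s t) b = (if b = s (Suc t) then c t else 0)" for b
      proof (cases "b = s (Suc t)")
        case False
        then have "\<not> (\<exists>t'. t' mod n = t mod n \<and> s t' = s t \<and> s (Suc t') = b)"
          using cyclic_walks_next[OF s] by metis
        then show ?thesis using False off by (simp only: walk_flow_def if_False)
      qed (simp add: c_def)
      then show ?thesis using cyclic_walks_less[OF s] by simp
    qed
    have inn: "(\<Sum>a<d. Q (t mod n) a (s (Suc t))) = c t" for t
    proof -
      have "Q (t mod n) a (s (Suc t)) = (if a = s t then c t else 0)" for a
      proof (cases "a = s t")
        case False
        then have "\<not> (\<exists>t'. t' mod n = t mod n \<and> s t' = a \<and> s (Suc t') = s (Suc t))"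
          using cyclic_walks_prev[OF s n k] by metis
        then show ?thesis using False off by (simp only: walk_flow_def if_False)
      qed (simp add: c_def)
      then show ?thesis using cyclic_walks_less[OF s] by simp
    qed
    have "c (Suc t) = c t" for t
    proof -
      have "(\<Sum>a<d. Q (t mod n) a (s (Suc t))) = (\<Sum>b<d. Q (Suc (t mod n) mod n) (s (Suc t)) b)"
        using Q cyclic_walks_less[OF s] n by (simp add: flows_def)
      then show ?thesis using inn out[of "Suc t"] by (simp add: mod_Suc_eq)
    qed
    then have c: "c t = c 0" for t by (induction t) auto
    have Qf: "Q i a b = c 0 * real k * ?f i a b" for i a b
    proof (cases "?f i a b = 0")
      case False
      then obtain t where "i = t mod n" "a = s t" "b = s (Suc t)" by (auto simp: walk_flow_def split: if_splits)
      then have "Q i a b = c 0" "?f i a b = 1 / real k" using c[of t] by (auto simp: c_def walk_flow_def)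
      then show ?thesis using k by simp
    qed (simp add: off)
    \<comment> \<open>Comparing total flows in layer 0 determines the remaining constant.\<close>
    have "(\<Sum>a<d. \<Sum>b<d. Q 0 a b) = c 0 * real k * (\<Sum>a<d. \<Sum>b<d. ?f 0 a b)"
      by (simp add: Qf sum_distrib_left)
    then have "c 0 * real k = 1" using Q walk_flow_in_flows[OF assms] n by (simp add: flows_def)
    then show ?thesis using Qf by (intro ext) simp
  qed
  then show ?thesis using walk_flow_in_flows[OF assms] by (auto simp: extremal_flows_def)
qed

text \<open>By conservation a positive edge can always be continued by a positive edge. With
  finitely many nodes such a walk must return, and a return after the fewest windings closes up to a
  simple cycle.\<close>

lemma flows_contain_cyclic_walk:
  assumes P: "P \<in> flows n d" and n: "0 < n"
  obtains k s where "0 < k" "s \<in> cyclic_walks n d k" "\<And>t. 0 < P (t mod n) (s t) (s (Suc t))"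
proof -
  have P0: "0 \<le> P i a b" for i a b using P by (simp add: flows_def)
  have supp: "i < n \<and> a < d \<and> b < d" if "0 < P i a b" for i a b
  proof -
    have "\<forall>i a b. \<not> (i < n \<and> a < d \<and> b < d) \<longrightarrow> P i a b = 0" using P unfolding flows_def by blast
    then show ?thesis using that by (metis order_less_irrefl)
  qed
  have step: "\<exists>c. 0 < P (Suc i mod n) b c" if "0 < P i a b" for i a b
  proof -
    have "0 < (\<Sum>a<d. P i a b)"
      using supp[OF that] P0 that by (intro sum_pos2[of _ a]) auto
    then have "0 < (\<Sum>c<d. P (Suc i mod n) b c)" using P supp[OF that] by (simp add: flows_def)
    then show ?thesis using P0 by (metis less_eq_real_def sum.neutral order_less_irrefl)
  qed
  have one: "(\<Sum>a<d. \<Sum>b<d. P 0 a b) = 1" using P n by (simp add: flows_def)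
  have "\<not> (\<forall>a b. P 0 a b = 0)"
  proof
    assume "\<forall>a b. P 0 a b = 0"
    then show False using one by simp
  qed
  then obtain a0 b0 where ab0: "0 < P 0 a0 b0" using P0 by (metis order_le_less)
  define g where "g i a = (SOME b. 0 < P i a b)" for i a
  have g: "0 < P i a (g i a)" if "0 < P i a b" for i a b
    unfolding g_def by (rule someI[of "\<lambda>b. 0 < P i a b", OF that])
  \<comment> \<open>Making each step a function of the current node turns any repetition into a period.\<close>
  define u where "u = rec_nat a0 (\<lambda>t a. g (t mod n) a)"
  have u0: "u 0 = a0" and uS: "u (Suc t) = g (t mod n) (u t)" for t by (simp_all add: u_def)
  have pos: "0 < P (t mod n) (u t) (u (Suc t))" for t
  proof (induction t)
    case 0
    then show ?case using g[OF ab0] by (simp add: u0 uS)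
  next
    case (Suc t)
    then show ?case using step[OF Suc] g uS[of "Suc t"] by (auto simp: mod_Suc_eq)
  qed
  have ud: "u t < d" for t using supp[OF pos[of t]] by simp
  have shift: "u (t + j) = u (t' + j)" if "u t = u t'" "t mod n = t' mod n" for t t' j
  proof (induction j)
    case (Suc j)
    have "(t + j) mod n = (t' + j) mod n" using that(2) by (metis mod_add_cong)
    then show ?case using Suc uS by simp
  qed (use that in simp)
  \<comment> \<open>A return after \<open>k\<close> windings, from any starting time. Minimality
    over all starting times is what excludes shorter returns inside the cycle.\<close>
  let ?rep = "\<lambda>k. 0 < k \<and> (\<exists>t. u (t + n * k) = u t)"
  have "\<exists>k. ?rep k"
  proof -
    \<comment> \<open>The times \<open>n * j\<close> all lie in layer 0, where only \<open>d\<close>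
      outcomes are available.\<close>
    have "\<not> inj (\<lambda>j. u (n * j))"
      using ud finite_subset[of "range (\<lambda>j. u (n * j))" "{..<d}"] finite_imageD infinite_UNIV_nat by blast
    then obtain j j' where "u (n * j) = u (n * j')" "j < j'" unfolding inj_def by (metis nat_neq_iff)
    then have "u (n * j + n * (j' - j)) = u (n * j)" by (simp add: algebra_simps)
    then show ?thesis using \<open>j < j'\<close> by (metis zero_less_diff)
  qed
  then obtain k where "?rep k" and min: "\<And>l. l < k \<Longrightarrow> \<not> ?rep l" using exists_least_iff[of ?rep] by blast
  then obtain t0 where k: "0 < k" and t0: "u (t0 + n * k) = u t0" by blast
  \<comment> \<open>The offset is \<open>n * t0\<close> and not \<open>t0\<close>: being a multiple
    of \<open>n\<close> it keeps time \<open>t\<close> in layer \<open>t mod n\<close>, and being at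
    least \<open>t0\<close> it lies in the part of \<open>u\<close> that is already
    periodic.\<close>
  define s where "s t = u (n * t0 + t)" for t
  have per: "s (t + n * k) = s t" for t
  proof -
    have "u (t0 + n * k + (n * t0 - t0 + t)) = u (t0 + (n * t0 - t0 + t))" by (rule shift) (use t0 in auto)
    moreover have "t0 \<le> n * t0" using n by simp
    ultimately show ?thesis by (simp add: s_def algebra_simps)
  qed
  have per': "s (t + n * k * m) = s t" for t m
  proof (induction m)
    case (Suc m)
    then show ?case using per[of "t + n * k * m"] by (simp add: algebra_simps)
  qed simp
  have inj: "t mod (n * k) = t' mod (n * k)" if "t mod n = t' mod n" "s t = s t'" "t \<le> t'" for t t'
  proof -
    have "n dvd t' - t" using mod_eq_dvd_iff_nat[OF that(3), of n] that(1) by simp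
    then obtain m where "t' - t = n * m" by (rule dvdE)
    then have m: "t' = t + n * m" using that(3) by simp
    \<comment> \<open>Removing whole periods from the distance \<open>n * m\<close> leaves a return
      after \<open>m mod k < k\<close> windings, so by minimality the remainder is 0.\<close>
    have "s (t + n * (m mod k)) = s (t + n * (m mod k) + n * k * (m div k))" using per' by simp
    also have "t + n * (m mod k) + n * k * (m div k) = t + n * (m mod k + k * (m div k))"
      by (simp only: algebra_simps)
    also have "\<dots> = t'" using m by simp
    finally have "s (t + n * (m mod k)) = s t" using that by simp
    then have "\<exists>t. u (t + n * (m mod k)) = u t" by (auto simp: s_def add.assoc[symmetric])
    then have "m mod k = 0" using min[of "m mod k"] k by auto
    then obtain q where "m = k * q" by auto
    then have "t' = t + n * k * q" using m by simp
    then show ?thesis by simp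
  qed
  have inj': "t mod (n * k) = t' mod (n * k)" if "t mod n = t' mod n" "s t = s t'" for t t'
    using inj[of t t'] inj[of t' t] that by fastforce
  have "s t < d" for t using ud by (simp add: s_def)
  then have "s \<in> cyclic_walks n d k"
    unfolding cyclic_walks_def mem_Collect_eq using per inj' by blast
  moreover have "0 < P (t mod n) (s t) (s (Suc t))" for t
    using pos[of "n * t0 + t"] by (simp add: s_def)
  ultimately show thesis using that k by blast
qed

text \<open>A walk flow inside the support of \<open>P\<close> is split off with a small weight
  \<open>e\<close>. The rescaled remainder \<open>R\<close> is again a circulation of total flow 1,
  so extremality identifies \<open>P\<close> with the part split off.\<close>

lemma extremal_flow_is_walk_flow:
  assumes P: "P \<in> extremal_flows n d" and n: "0 < n"
  obtains k s where "0 < k" "s \<in> cyclic_walks n d k" "P = walk_flow n k s"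
proof -
  have PF: "P \<in> flows n d" using P by (simp add: extremal_flows_def)
  obtain k s where k: "0 < k" and s: "s \<in> cyclic_walks n d k" and pos: "\<And>t. 0 < P (t mod n) (s t) (s (Suc t))"
    using flows_contain_cyclic_walk[OF PF n] by blast
  let ?f = "walk_flow n k s"
  have f: "?f \<in> flows n d" by (rule walk_flow_in_flows[OF s n k])
  let ?D = "(\<lambda>t. P (t mod n) (s t) (s (Suc t))) ` {..<n * k}"
  have D: "finite ?D" "?D \<noteq> {}" using n k by (auto simp: lessThan_empty_iff)
  \<comment> \<open>The minimum of \<open>P\<close> along the cycle suffices for nonnegativity of
    the remainder, since the walk flow is at most 1. The bound 1/2 keeps \<open>1 - e\<close>
    positive.\<close>
  define e where "e = min (1/2) (Min ?D)"
  have e: "0 < e" "e < 1" using D pos by (auto simp: e_def)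
  have le: "e \<le> P (t mod n) (s t) (s (Suc t))" for t
  proof -
    let ?t = "t mod (n * k)"
    have "?t mod n = t mod n" by (simp add: mod_mod_cancel)
    moreover have "s ?t = s t" by (rule cyclic_walks_cong[OF s]) simp
    moreover have "s (Suc ?t) = s (Suc t)" by (rule cyclic_walks_cong[OF s]) (simp add: mod_Suc_eq)
    moreover have "Min ?D \<le> P (?t mod n) (s ?t) (s (Suc ?t))" using D n k by (intro Min_le) auto
    ultimately show ?thesis by (simp add: e_def)
  qed
  have ef: "e * ?f i a b \<le> P i a b" for i a b
  proof (cases "?f i a b = 0")
    case False
    then obtain t where t: "i = t mod n" "a = s t" "b = s (Suc t)" by (auto simp: walk_flow_def split: if_splits)
    have "?f i a b \<le> 1" using k by (simp add: walk_flow_def)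
    then have "e * ?f i a b \<le> e" using e by (simp add: mult_left_le)
    then show ?thesis using le[of t] t by simp
  qed (use PF in \<open>simp add: flows_def\<close>)
  define R where "R i a b = (P i a b - e * ?f i a b) / (1 - e)" for i a b
  have "R \<in> flows n d"
  proof -
    have "(\<Sum>a<d. \<Sum>b<d. R i a b) = 1" if "i < n" for i
    proof -
      have "(\<Sum>a<d. \<Sum>b<d. R i a b) = ((\<Sum>a<d. \<Sum>b<d. P i a b) - e * (\<Sum>a<d. \<Sum>b<d. ?f i a b)) / (1 - e)"
        by (simp add: R_def sum_subtractf sum_distrib_left flip: sum_divide_distrib)
      then show ?thesis using PF f e that by (simp add: flows_def)
    qed
    moreover have "(\<Sum>a<d. R i a b) = (\<Sum>c<d. R (Suc i mod n) b c)" if "i < n" "b < d" for i b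
    proof -
      have "(\<Sum>a<d. R i a b) = ((\<Sum>a<d. P i a b) - e * (\<Sum>a<d. ?f i a b)) / (1 - e)"
        by (simp add: R_def sum_subtractf sum_distrib_left flip: sum_divide_distrib)
      also have "\<dots> = ((\<Sum>c<d. P (Suc i mod n) b c) - e * (\<Sum>c<d. ?f (Suc i mod n) b c)) / (1 - e)"
        using PF f that by (simp add: flows_def)
      also have "\<dots> = (\<Sum>c<d. R (Suc i mod n) b c)"
        by (simp add: R_def sum_subtractf sum_distrib_left flip: sum_divide_distrib)
      finally show ?thesis .
    qed
    moreover have "R i a b = 0" if "\<not> (i < n \<and> a < d \<and> b < d)" for i a b
      using PF f that by (auto simp: flows_def R_def)
    moreover have "0 \<le> R i a b" for i a b using ef e by (simp add: R_def)
    ultimately show ?thesis by (simp add: flows_def)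
  qed
  moreover have "P = (\<lambda>i a b. e * ?f i a b + (1 - e) * R i a b)" using e by (simp add: R_def)
  ultimately have "P = ?f" using P f e unfolding extremal_flows_def by force
  then show thesis using that k s by blast
qed

lemma extremal_flows_eq:
  assumes n: "0 < n"
  shows "extremal_flows n d = (\<Union>k\<in>{1..d}. walk_flow n k ` cyclic_walks n d k)"
proof (intro equalityI subsetI)
  fix P assume "P \<in> extremal_flows n d"
  then obtain k s where k: "0 < k" and s: "s \<in> cyclic_walks n d k" and P: "P = walk_flow n k s"
    using extremal_flow_is_walk_flow[OF _ n] by blast
  then have "k \<in> {1..d}" using cyclic_walks_length_le[OF s n k] by simp
  then show "P \<in> (\<Union>k\<in>{1..d}. walk_flow n k ` cyclic_walks n d k)" using s P by blast
qed (use extremal_walk_flow[OF _ n] in auto)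

section \<open>Counting simple cycles\<close>

text \<open>A time splits into its layer \<open>t mod n\<close> and its winding
  \<open>t div n mod k\<close>. Any node may follow any node of the previous layer, so the only
  constraint is injectivity in the winding, separately for each layer.\<close>

lemma bij_betw_cyclic_walks:
  assumes n: "0 < n" and k: "0 < k"
  shows "bij_betw (\<lambda>w t. w (t mod n) (t div n mod k))
    ({..<n} \<rightarrow>\<^sub>E {f \<in> {..<k} \<rightarrow>\<^sub>E {..<d}. inj_on f {..<k}}) (cyclic_walks n d k)"
proof (rule bij_betw_byWitness[where f' = "\<lambda>s. \<lambda>i\<in>{..<n}. \<lambda>j\<in>{..<k}. s (i + n * j)"])
  let ?W = "{..<n} \<rightarrow>\<^sub>E {f \<in> {..<k} \<rightarrow>\<^sub>E {..<d}. inj_on f {..<k}}"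
  show "\<forall>w\<in>?W. (\<lambda>i\<in>{..<n}. \<lambda>j\<in>{..<k}. w ((i + n * j) mod n) ((i + n * j) div n mod k)) = w"
  proof
    fix w assume w: "w \<in> ?W"
    show "(\<lambda>i\<in>{..<n}. \<lambda>j\<in>{..<k}. w ((i + n * j) mod n) ((i + n * j) div n mod k)) = w"
    proof (rule ext)+
      fix i j
      show "(\<lambda>i\<in>{..<n}. \<lambda>j\<in>{..<k}. w ((i + n * j) mod n) ((i + n * j) div n mod k)) i j = w i j"
      proof (cases "i < n")
        case True
        then have "w i \<in> {..<k} \<rightarrow>\<^sub>E {..<d}" using w by auto
        then show ?thesis using True by (auto simp: restrict_def PiE_def extensional_def)
      qed (use w in \<open>auto simp: PiE_def extensional_def\<close>)
    qed
  qed
  show "\<forall>s\<in>cyclic_walks n d k. (\<lambda>t. (\<lambda>i\<in>{..<n}. \<lambda>j\<in>{..<k}. s (i + n * j)) (t mod n) (t div n mod k)) = s"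
  proof (intro ballI ext)
    fix s t assume "s \<in> cyclic_walks n d k"
    moreover have "t mod n + n * (t div n mod k) = t mod (n * k)" by (simp add: mod_mult2_eq)
    ultimately show "(\<lambda>i\<in>{..<n}. \<lambda>j\<in>{..<k}. s (i + n * j)) (t mod n) (t div n mod k) = s t"
      using n k by (auto intro: cyclic_walks_cong)
  qed
  show "(\<lambda>w t. w (t mod n) (t div n mod k)) ` ?W \<subseteq> cyclic_walks n d k"
  proof (clarify)
    fix w assume w: "w \<in> ?W"
    have wi: "inj_on (w i) {..<k}" "w i \<in> {..<k} \<rightarrow> {..<d}" if "i < n" for i using w that by (auto simp: PiE_def)
    have A: "w (t mod n) (t div n mod k) < d" for t using wi(2)[of "t mod n"] n k by auto
    have B: "w ((t + n * k) mod n) ((t + n * k) div n mod k) = w (t mod n) (t div n mod k)" for t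
      using n by simp
    have C: "t mod (n * k) = t' mod (n * k)"
      if "t mod n = t' mod n" "w (t mod n) (t div n mod k) = w (t' mod n) (t' div n mod k)" for t t'
    proof -
      have "t div n mod k = t' div n mod k"
        using wi(1)[of "t mod n"] that n k by (auto simp: inj_on_def)
      then show ?thesis using that by (simp add: mod_mult2_eq)
    qed
    show "(\<lambda>t. w (t mod n) (t div n mod k)) \<in> cyclic_walks n d k"
      unfolding cyclic_walks_def mem_Collect_eq using A B C by blast
  qed
  show "(\<lambda>s. \<lambda>i\<in>{..<n}. \<lambda>j\<in>{..<k}. s (i + n * j)) ` cyclic_walks n d k \<subseteq> ?W"
  proof (clarify)
    fix s assume s: "s \<in> cyclic_walks n d k"
    have "inj_on (\<lambda>j\<in>{..<k}. s (i + n * j)) {..<k}" if "i < n" for i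
    proof (rule inj_onI)
      fix j j'
      assume j: "j \<in> {..<k}" "j' \<in> {..<k}"
        "(\<lambda>j\<in>{..<k}. s (i + n * j)) j = (\<lambda>j\<in>{..<k}. s (i + n * j)) j'"
      then have "(i + n * j) mod (n * k) = (i + n * j') mod (n * k)"
        by (intro cyclic_walks_inj[OF s]) auto
      then show "j = j'" using j that by (simp add: mod_mult2_eq)
    qed
    then show "(\<lambda>i\<in>{..<n}. \<lambda>j\<in>{..<k}. s (i + n * j)) \<in> ?W"
      using cyclic_walks_less[OF s] by (auto simp: PiE_def)
  qed
qed

lemma card_cyclic_walks:
  assumes "0 < n" and "0 < k" and "k \<le> d"
  shows "card (cyclic_walks n d k) = ((d choose k) * fact k) ^ n" and "finite (cyclic_walks n d k)"
proof -
  let ?I = "{f \<in> {..<k} \<rightarrow>\<^sub>E {..<d}. inj_on f {..<k}}"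
  \<comment> \<open>The left side is the falling factorial that counts injections. In the induction
    both sides of the binomial identity reduce to \<open>d * ((d - 1) choose k)\<close>.\<close>
  have "prod ((-) d) {0..<k} = (d choose k) * fact k" for k
  proof (induction k)
    case (Suc k)
    have "Suc k * (d choose Suc k) = (d - k) * (d choose k)"
      by (simp only: binomial_absorption binomial_absorb_comp)
    then show ?case using Suc by (simp only: prod.atLeast0_lessThan_Suc fact_Suc of_nat_id) (metis mult.assoc mult.commute)
  qed simp
  then have I: "card ?I = (d choose k) * fact k"
    using card_inj_on_subset_funcset[of "{..<k}" "{..<d}" "{..<k}"] by simp
  show "card (cyclic_walks n d k) = ((d choose k) * fact k) ^ n"
    using bij_betw_same_card[OF bij_betw_cyclic_walks[OF assms(1,2)], of d] I by (simp add: card_PiE)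
  have "finite ?I" by (simp add: finite_PiE)
  then show "finite (cyclic_walks n d k)"
    using bij_betw_finite[OF bij_betw_cyclic_walks[OF assms(1,2)], of d] finite_PiE[of "{..<n}" "\<lambda>_. ?I"] by auto
qed

text \<open>A simple cycle of winding number \<open>k\<close> has \<open>k\<close> nodes in layer 0, hence comes from exactly \<open>k\<close> of the
  walks with a starting point.\<close>

lemma bij_betw_based_walks:
  assumes n: "0 < n" and k: "0 < k"
  shows "bij_betw (\<lambda>s. (walk_flow n k s, s 0)) (cyclic_walks n d k)
    (SIGMA P : walk_flow n k ` cyclic_walks n d k. {a. \<exists>b. P 0 a b \<noteq> 0})"
  unfolding bij_betw_def
proof
  show "inj_on (\<lambda>s. (walk_flow n k s, s 0)) (cyclic_walks n d k)"
  proof (rule inj_onI, rule ext)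
    fix s s' t
    assume s: "s \<in> cyclic_walks n d k" and s': "s' \<in> cyclic_walks n d k"
      and eq: "(walk_flow n k s, s 0) = (walk_flow n k s', s' 0)"
    show "s t = s' t"
    proof (induction t)
      case (Suc t)
      \<comment> \<open>The edge that \<open>s\<close> uses at time \<open>t\<close> lies in the
        common flow, hence is used by \<open>s'\<close> at some time. The two walks agree at time
        \<open>t\<close>, and the successor of a node on \<open>s'\<close> is unique.\<close>
      have "walk_flow n k s (t mod n) (s t) (s (Suc t)) \<noteq> 0"
        unfolding walk_flow_nonzero_iff[OF k] by blast
      then have "walk_flow n k s' (t mod n) (s t) (s (Suc t)) \<noteq> 0" using eq by simp
      then obtain t' where "t' mod n = t mod n" "s' t' = s t" "s' (Suc t') = s (Suc t)"
        unfolding walk_flow_nonzero_iff[OF k] by blast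
      then show ?case using cyclic_walks_next[OF s', of t' t] Suc by simp
    qed (use eq in simp)
  qed
  show "(\<lambda>s. (walk_flow n k s, s 0)) ` cyclic_walks n d k =
    (SIGMA P : walk_flow n k ` cyclic_walks n d k. {a. \<exists>b. P 0 a b \<noteq> 0})"
  proof (intro equalityI subsetI)
    fix x assume "x \<in> (\<lambda>s. (walk_flow n k s, s 0)) ` cyclic_walks n d k"
    then obtain s where "s \<in> cyclic_walks n d k" "x = (walk_flow n k s, s 0)" by auto
    moreover have "walk_flow n k s 0 (s 0) (s (Suc 0)) \<noteq> 0"
      unfolding walk_flow_nonzero_iff[OF k] by (rule exI[of _ 0]) simp
    ultimately show "x \<in> (SIGMA P : walk_flow n k ` cyclic_walks n d k. {a. \<exists>b. P 0 a b \<noteq> 0})" by blast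
  next
    fix x assume "x \<in> (SIGMA P : walk_flow n k ` cyclic_walks n d k. {a. \<exists>b. P 0 a b \<noteq> 0})"
    then obtain s a b where s: "s \<in> cyclic_walks n d k" and x: "x = (walk_flow n k s, a)"
      and ab: "walk_flow n k s 0 a b \<noteq> 0" by auto
    then obtain r where "r mod n = 0" and r: "s r = a"
      using walk_flow_nonzero_iff[OF k] by metis
    then obtain q where q: "r = n * q" by auto
    \<comment> \<open>The walk rotated to start at \<open>a\<close>. The shift \<open>r\<close> is a
      multiple of \<open>n\<close>, because \<open>a\<close> is a node in layer 0, so layers are
      preserved.\<close>
    define s' where "s' t = s (t + r)" for t
    have "s' \<in> cyclic_walks n d k"
    proof -
      have C: "t mod (n * k) = t' mod (n * k)" if "t mod n = t' mod n" "s' t = s' t'" for t t'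
      proof -
        have "(t + r) mod (n * k) = (t' + r) mod (n * k)"
          using that by (intro cyclic_walks_inj[OF s]) (auto simp: s'_def q)
        \<comment> \<open>The rotation is undone by adding its complement to \<open>r\<close> whole
          periods, which avoids subtracting \<open>r\<close> from a time.\<close>
        then have "(t + r + (n * k * r - r)) mod (n * k) = (t' + r + (n * k * r - r)) mod (n * k)"
          by (rule mod_add_cong) simp
        moreover have "t + r + (n * k * r - r) = t + n * k * r" for t using n k by simp
        ultimately show ?thesis by simp
      qed
      have B: "s' (t + n * k) = s' t" for t
        unfolding s'_def by (rule cyclic_walks_cong[OF s]) (metis add.assoc add.commute mod_add_self2)
      have A: "s' t < d" for t using cyclic_walks_less[OF s] by (simp add: s'_def)
      show ?thesis unfolding cyclic_walks_def mem_Collect_eq using A B C by blast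
    qed
    moreover have "walk_flow n k s' = walk_flow n k s"
    proof -
      have "(\<exists>t. t mod n = i \<and> s' t = a \<and> s' (Suc t) = b) \<longleftrightarrow>
            (\<exists>t. t mod n = i \<and> s t = a \<and> s (Suc t) = b)" for i a b
      proof
        assume "\<exists>t. t mod n = i \<and> s' t = a \<and> s' (Suc t) = b"
        then obtain t where t: "t mod n = i" "s' t = a" "s' (Suc t) = b" by blast
        have "(t + r) mod n = i" "s (t + r) = a" "s (Suc (t + r)) = b" using t by (auto simp: s'_def q)
        then show "\<exists>t. t mod n = i \<and> s t = a \<and> s (Suc t) = b" by blast
      next
        assume "\<exists>t. t mod n = i \<and> s t = a \<and> s (Suc t) = b"
        then obtain t where t: "t mod n = i" "s t = a" "s (Suc t) = b" by blast
        \<comment> \<open>The same complement: \<open>t' + r\<close> is \<open>t\<close> plus whole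
          periods.\<close>
        define t' where "t' = t + (n * k * r - r)"
        have "r \<le> n * k * r" using n k by simp
        then have tr: "t' + r = t + n * k * r" unfolding t'_def by linarith
        have "t' mod n = (t' + r) mod n" by (simp add: q)
        also have "\<dots> = i" unfolding tr using t by (simp add: mult.assoc)
        finally have "t' mod n = i" .
        moreover have "s' t' = a" "s' (Suc t') = b"
          unfolding s'_def add_Suc tr t(2,3)[symmetric]
          by (rule cyclic_walks_cong[OF s], simp only: add_Suc[symmetric] mod_mult_self2)+
        ultimately show "\<exists>t. t mod n = i \<and> s' t = a \<and> s' (Suc t) = b" by blast
      qed
      then show ?thesis unfolding walk_flow_def by presburger
    qed
    moreover have "s' 0 = a" using r by (simp add: s'_def)
    ultimately show "x \<in> (\<lambda>s. (walk_flow n k s, s 0)) ` cyclic_walks n d k"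
      using x by (metis (no_types, lifting) image_eqI)
  qed
qed

text \<open>Counting based walks in two ways: each cycle accounts for \<open>k\<close> of them.
  Dividing by \<open>k\<close> turns one of the \<open>n\<close> factors \<open>fact k\<close> into
  \<open>fact (k - 1)\<close>.\<close>

lemma card_walk_flows:
  assumes n: "0 < n" and k: "0 < k" "k \<le> d"
  shows "card (walk_flow n k ` cyclic_walks n d k) = (d choose k) ^ n * fact k ^ (n - 1) * fact (k - 1)"
proof -
  let ?V = "walk_flow n k ` cyclic_walks n d k"
  have fib: "card {a. \<exists>b. P 0 a b \<noteq> 0} = k" if "P \<in> ?V" for P
  proof -
    obtain s where s: "s \<in> cyclic_walks n d k" "P = walk_flow n k s" using \<open>P \<in> ?V\<close> by blast
    have "{a. \<exists>b. P 0 a b \<noteq> 0} = {a. \<exists>t. t mod n = 0 \<and> s t = a}"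
      unfolding s(2) walk_flow_nonzero_iff[OF k(1)] by (rule Collect_cong) metis
    then show ?thesis using card_cyclic_walks_layer[OF s(1) n k(1) n] by simp
  qed
  \<comment> \<open>Finiteness is read off from the positive cardinality, as infinite sets have
    cardinality 0.\<close>
  then have "\<forall>P\<in>?V. finite {a. \<exists>b. P 0 a b \<noteq> 0}" using k card.infinite by (metis less_irrefl)
  then have "card (cyclic_walks n d k) = card ?V * k"
    using bij_betw_same_card[OF bij_betw_based_walks[OF n k(1)], of d] card_cyclic_walks(2)[OF n k] fib
    by (subst (asm) card_SigmaI) auto
  moreover have "card (cyclic_walks n d k) = (d choose k) ^ n * fact k ^ (n - 1) * fact (k - 1) * k"
  proof -
    have "(fact k :: nat) ^ n = fact k ^ (n - 1) * (fact (k - 1) * k)"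
      using n k by (metis fact_reduce mult.commute power_minus_mult of_nat_id)
    then show ?thesis using card_cyclic_walks(1)[OF n k] by (simp add: power_mult_distrib)
  qed
  ultimately show ?thesis using k by simp
qed

lemma card_extremal_flows:
  assumes n: "0 < n"
  shows "card (extremal_flows n d) = (\<Sum>k = 1..d. (d choose k) ^ n * fact k ^ (n - 1) * fact (k - 1))"
proof -
  \<comment> \<open>A flow reveals its winding number, since its nonzero values are
    \<open>1 / real k\<close>.\<close>
  have "walk_flow n k ` cyclic_walks n d k \<inter> walk_flow n l ` cyclic_walks n d l = {}"
    if "k \<in> {1..d}" "l \<in> {1..d}" "k \<noteq> l" for k l
  proof (rule ccontr)
    assume "\<not> ?thesis"
    then obtain s s' where eq: "walk_flow n k s = walk_flow n l s'" by auto
    have "walk_flow n k s 0 (s 0) (s (Suc 0)) = 1 / real k"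
      by (auto simp: walk_flow_def intro: exI[of _ 0])
    then have "walk_flow n l s' 0 (s 0) (s (Suc 0)) = 1 / real k" using eq by simp
    then show False using that by (auto simp: walk_flow_def split: if_splits)
  qed
  then have "card (extremal_flows n d) = (\<Sum>k\<in>{1..d}. card (walk_flow n k ` cyclic_walks n d k))"
    unfolding extremal_flows_eq[OF n] using card_cyclic_walks(2)[OF n]
    by (intro card_UN_disjoint) auto
  also have "\<dots> = (\<Sum>k = 1..d. (d choose k) ^ n * fact k ^ (n - 1) * fact (k - 1))"
    by (intro sum.cong refl) (simp add: card_walk_flows[OF n])
  finally show ?thesis .
qed

section \<open>Distributions on one edge\<close>

text \<open>The pull-back along the map \<open>[m] \<rightarrow> [1]\<close> that sends exactly \<open>0, \<dots>, k - 1\<close> to 0.\<close>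

definition spread :: "nat \<Rightarrow> nat \<Rightarrow> nat list \<Rightarrow> nat list" where
  "spread m k xs = replicate k (xs ! 0) @ replicate (Suc m - k) (xs ! 1)"

lemma length_spread: "k \<le> Suc m \<Longrightarrow> length (spread m k xs) = Suc m"
  by (simp add: spread_def)

lemma nth_spread: "k \<le> Suc m \<Longrightarrow> t < Suc m \<Longrightarrow> spread m k xs ! t = xs ! (if t < k then 0 else 1)"
  by (simp add: spread_def nth_append)

text \<open>The deleted coordinate belongs to the first or to the second block. For
  \<open>k = 1\<close> and \<open>j = 0\<close> the first block disappears and
  \<open>spread m 0\<close> results, the constant tuple at the end point; this index does not occur
  in the model, which names that simplex by the next edge.\<close>

lemma face_spread:
  assumes "k \<le> Suc (Suc m)" "j \<le> Suc m"
  shows "face (Delta U) (Suc m) j (spread (Suc m) k xs) = spread m (if j < k then k - 1 else k) xs"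
  using assms by (intro nth_equalityI) (auto simp: length_spread nth_spread face_Delta)

lemma degen_spread:
  assumes "k \<le> Suc m" "j \<le> m"
  shows "degen (Delta U) m j (spread m k xs) = spread (Suc m) (if j < k then Suc k else k) xs"
  using assms by (intro nth_equalityI) (auto simp: length_spread nth_spread degen_Delta)

lemma mem_Delta_1: "xs \<in> simplices (Delta (Z_mod d)) 1 \<longleftrightarrow> (\<exists>a<d. \<exists>b<d. xs = [a, b])"
  by (auto simp: Delta_def length_Suc_conv)

lemma spread_in_Delta:
  assumes "k \<le> Suc m"
  shows "spread m k \<in> simplices (Delta (Z_mod d)) 1 \<rightarrow> simplices (Delta (Z_mod d)) m"
proof
  fix xs assume "xs \<in> simplices (Delta (Z_mod d)) 1"
  then obtain a b where "a < d" "b < d" "xs = [a, b]" unfolding mem_Delta_1 by auto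
  then show "spread m k xs \<in> simplices (Delta (Z_mod d)) m"
    using assms by (auto simp: Delta_def spread_def)
qed

lemma spread_1_1: "xs \<in> simplices (Delta (Z_mod d)) 1 \<Longrightarrow> spread 1 1 xs = xs"
  unfolding mem_Delta_1 by (auto simp: spread_def)

lemma face_Delta_pair: "face (Delta U) 1 0 [a, b] = [b]" "face (Delta U) 1 1 [a, b] = [a]"
  by (simp_all add: Delta_def)

lemma Delta_1_eq: "simplices (Delta (Z_mod d)) 1 = (\<lambda>(a, b). [a, b]) ` ({..<d} \<times> {..<d})"
  using mem_Delta_1 by auto

lemma finite_Delta_1: "finite (simplices (Delta (Z_mod d)) 1)"
  unfolding Delta_1_eq by simp

lemma sum_Delta_1: "(\<Sum>xs\<in>simplices (Delta (Z_mod d)) 1. h xs) = (\<Sum>a<d. \<Sum>b<d. h [a, b])"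
proof -
  have "inj_on (\<lambda>(a, b). [a, b]) ({..<d} \<times> {..<d})" by (auto simp: inj_on_def)
  then show ?thesis unfolding Delta_1_eq
    by (simp add: sum.reindex sum.cartesian_product case_prod_unfold)
qed

lemma dist_on_Delta_1:
  "q \<in> dist_on (simplices (Delta (Z_mod d)) 1) \<longleftrightarrow>
     (\<forall>xs. 0 \<le> q xs) \<and> (\<forall>xs. xs \<notin> simplices (Delta (Z_mod d)) 1 \<longrightarrow> q xs = 0) \<and>
     (\<Sum>a<d. \<Sum>b<d. q [a, b]) = 1"
proof -
  have "finite {xs. q xs \<noteq> 0} \<and> (\<Sum>xs | q xs \<noteq> 0. q xs) = (\<Sum>a<d. \<Sum>b<d. q [a, b])"
    if "\<forall>xs. xs \<notin> simplices (Delta (Z_mod d)) 1 \<longrightarrow> q xs = 0"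
  proof
    have sub: "{xs. q xs \<noteq> 0} \<subseteq> simplices (Delta (Z_mod d)) 1" using that by blast
    then show "finite {xs. q xs \<noteq> 0}" using finite_Delta_1 finite_subset by blast
    have "(\<Sum>xs | q xs \<noteq> 0. q xs) = (\<Sum>xs\<in>simplices (Delta (Z_mod d)) 1. q xs)"
      using sub finite_Delta_1 by (intro sum.mono_neutral_left) auto
    then show "(\<Sum>xs | q xs \<noteq> 0. q xs) = (\<Sum>a<d. \<Sum>b<d. q [a, b])" by (simp only: sum_Delta_1)
  qed
  then show ?thesis unfolding dist_on_def mem_Collect_eq by metis
qed

text \<open>Summing over all pairs instead of the support of \<open>q\<close> makes the expression
  visibly linear in \<open>q\<close>, as needed for convex combinations.\<close>

lemma push_forward_Delta_1:
  assumes "q \<in> dist_on (simplices (Delta (Z_mod d)) 1)"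
  shows "push_forward f q y = (\<Sum>a<d. \<Sum>b<d. if f [a, b] = y then q [a, b] else 0)"
proof -
  have sub: "{xs. q xs \<noteq> 0} \<subseteq> simplices (Delta (Z_mod d)) 1" using assms by (auto simp: dist_on_def)
  then have "push_forward f q y = (\<Sum>xs | q xs \<noteq> 0. if f xs = y then q xs else 0)"
    using finite_Delta_1 finite_subset by (blast intro: push_forward_eq_sum)
  also have "\<dots> = (\<Sum>xs\<in>simplices (Delta (Z_mod d)) 1. if f xs = y then q xs else 0)"
    using sub finite_Delta_1 by (intro sum.mono_neutral_left) auto
  finally show ?thesis by (simp only: sum_Delta_1)
qed

text \<open>Deleting coordinate 0 leaves the marginal at the end point, deleting coordinate 1 the
  marginal at the start point. This is where simplicial compatibility becomes conservation of
  flow.\<close>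

lemma push_forward_face_eq_iff:
  assumes q: "q \<in> dist_on (simplices (Delta (Z_mod d)) 1)" and r: "r \<in> dist_on (simplices (Delta (Z_mod d)) 1)"
  shows "push_forward (face (Delta (Z_mod d)) 1 0) q = push_forward (face (Delta (Z_mod d)) 1 1) r \<longleftrightarrow>
    (\<forall>b<d. (\<Sum>a<d. q [a, b]) = (\<Sum>c<d. r [b, c]))"
proof -
  have ev0: "push_forward (face (Delta (Z_mod d)) 1 0) q y = (\<Sum>a<d. \<Sum>b<d. if [b] = y then q [a, b] else 0)" for y
    by (simp only: push_forward_Delta_1[OF q] face_Delta_pair)
  have ev1: "push_forward (face (Delta (Z_mod d)) 1 1) r y = (\<Sum>a<d. \<Sum>b<d. if [a] = y then r [a, b] else 0)" for y
    by (simp only: push_forward_Delta_1[OF r] face_Delta_pair)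
  have at0: "push_forward (face (Delta (Z_mod d)) 1 0) q [b] = (\<Sum>a<d. q [a, b])" if "b < d" for b
    unfolding ev0 using that by simp
  have at1: "push_forward (face (Delta (Z_mod d)) 1 1) r [a] = (\<Sum>b<d. r [a, b])" if "a < d" for a
    unfolding ev1 using that by (subst sum.swap) simp
  show ?thesis
  proof
    assume "push_forward (face (Delta (Z_mod d)) 1 0) q = push_forward (face (Delta (Z_mod d)) 1 1) r"
    then show "\<forall>b<d. (\<Sum>a<d. q [a, b]) = (\<Sum>c<d. r [b, c])" using at0 at1 by metis
  next
    assume eq: "\<forall>b<d. (\<Sum>a<d. q [a, b]) = (\<Sum>c<d. r [b, c])"
    show "push_forward (face (Delta (Z_mod d)) 1 0) q = push_forward (face (Delta (Z_mod d)) 1 1) r"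
    proof
      fix y
      show "push_forward (face (Delta (Z_mod d)) 1 0) q y = push_forward (face (Delta (Z_mod d)) 1 1) r y"
      proof (cases "\<exists>b<d. y = [b]")
        case True
        then show ?thesis using eq at0 at1 by auto
      next
        case False
        then have "push_forward (face (Delta (Z_mod d)) 1 0) q y = 0"
          unfolding ev0 by (intro sum.neutral ballI) auto
        moreover have "push_forward (face (Delta (Z_mod d)) 1 1) r y = 0"
          unfolding ev1 using False by (intro sum.neutral ballI) auto
        ultimately show ?thesis by simp
      qed
    qed
  qed
qed

text \<open>The shift \<open>i - 1\<close> mediates between edges numbered from 1 and layers
  numbered from 0. Outcomes out of range need no test, because a circulation vanishes there.\<close>

definition edge_dist :: "(nat \<Rightarrow> nat \<Rightarrow> nat \<Rightarrow> real) \<Rightarrow> nat \<Rightarrow> nat list \<Rightarrow> real" where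
  "edge_dist P i xs = (if length xs = 2 then P (i - 1) (xs ! 0) (xs ! 1) else 0)"

lemma edge_dist_pair [simp]: "edge_dist P i [a, b] = P (i - 1) a b"
  by (simp add: edge_dist_def)

lemma edge_dist_in_dist_on:
  assumes P: "P \<in> flows n d" and i: "i \<in> {1..n}"
  shows "edge_dist P i \<in> dist_on (simplices (Delta (Z_mod d)) 1)"
proof -
  have "edge_dist P i xs = 0" if "xs \<notin> simplices (Delta (Z_mod d)) 1" for xs
  proof (cases "length xs = 2")
    case True
    then obtain a b where xs: "xs = [a, b]" by (auto simp: length_Suc_conv numeral_2_eq_2)
    then have "\<not> (a < d \<and> b < d)" using that unfolding mem_Delta_1 by blast
    then show ?thesis using P xs by (auto simp: flows_def)
  qed (simp add: edge_dist_def)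
  moreover have "(\<Sum>a<d. \<Sum>b<d. edge_dist P i [a, b]) = 1" using P i by (auto simp: flows_def)
  moreover have "0 \<le> edge_dist P i xs" for xs using P by (auto simp: flows_def edge_dist_def)
  ultimately show ?thesis unfolding dist_on_Delta_1 by blast
qed

lemma circle_next_eq_mod: "i \<in> {1..n} \<Longrightarrow> circle_next n i - 1 = Suc (i - 1) mod n"
  by (auto simp: circle_next_def)

lemma edge_dist_compatible:
  assumes P: "P \<in> flows n d" and i: "i \<in> {1..n}"
  shows "push_forward (face (Delta (Z_mod d)) 1 0) (edge_dist P i) =
    push_forward (face (Delta (Z_mod d)) 1 1) (edge_dist P (circle_next n i))"
proof -
  have n: "1 \<le> n" using i by simp
  have "i - 1 < n" using i by auto
  then have "(\<Sum>a<d. P (i - 1) a b) = (\<Sum>c<d. P (Suc (i - 1) mod n) b c)" if "b < d" for b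
    using P that unfolding flows_def by blast
  then show ?thesis
    unfolding push_forward_face_eq_iff[OF edge_dist_in_dist_on[OF P i] edge_dist_in_dist_on[OF P circle_next_range[OF n i]]]
    unfolding edge_dist_pair circle_next_eq_mod[OF i] by blast
qed

section \<open>Simplicial distributions on the circle\<close>

locale directed_circle =
  fixes n :: nat and C :: "'a sset" and \<sigma> v :: "nat \<Rightarrow> 'a"
  assumes n_pos: "1 \<le> n" and is_circle: "is_circle n C \<sigma> v"
begin

abbreviation M where "M \<equiv> circle_model n"

text \<open>The isomorphism from the model \<open>M\<close> to \<open>C\<close>.\<close>

primrec circle_simplex :: "nat \<Rightarrow> nat \<times> nat \<Rightarrow> 'a" where
  "circle_simplex 0 = (\<lambda>(i, k). v i)"
| "circle_simplex (Suc m) = (\<lambda>(i, k).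
     if 1 < k then degen C m 0 (circle_simplex m (i, k - 1))
     else if m = 0 then \<sigma> i else degen C m m (circle_simplex m (i, 1)))"

section \<open>The circle is isomorphic to its model\<close>

lemma simplicial_C: "simplicial_set C"
  using is_circle by (simp add: is_circle_def)

lemma degen_closed: "x \<in> simplices C m \<Longrightarrow> j \<le> m \<Longrightarrow> degen C m j x \<in> simplices C (Suc m)"
  using simplicial_C[unfolded simplicial_set_def,
    THEN conjunct2, THEN conjunct1]
  by blast

lemma degen_degen: "x \<in> simplices C m \<Longrightarrow> i \<le> j \<Longrightarrow> j \<le> m \<Longrightarrow>
    degen C (Suc m) i (degen C m j x) = degen C (Suc m) (Suc j) (degen C m i x)"
  using simplicial_C[unfolded simplicial_set_def,
    THEN conjunct2, THEN conjunct2, THEN conjunct2, THEN conjunct1]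
  by blast

lemma face_degen_less: "x \<in> simplices C (Suc m) \<Longrightarrow> i < j \<Longrightarrow> j \<le> Suc m \<Longrightarrow>
    face C (Suc (Suc m)) i (degen C (Suc m) j x) = degen C m (j - 1) (face C (Suc m) i x)"
  using simplicial_C[unfolded simplicial_set_def,
    THEN conjunct2, THEN conjunct2, THEN conjunct2, THEN conjunct2, THEN conjunct1]
  by blast

lemma face_degen_same: "x \<in> simplices C m \<Longrightarrow> j \<le> m \<Longrightarrow> face C (Suc m) j (degen C m j x) = x"
    "x \<in> simplices C m \<Longrightarrow> j \<le> m \<Longrightarrow> face C (Suc m) (Suc j) (degen C m j x) = x"
  using simplicial_C[unfolded simplicial_set_def,
    THEN conjunct2, THEN conjunct2, THEN conjunct2, THEN conjunct2, THEN conjunct2, THEN conjunct1]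
  by blast+

lemma face_degen_greater: "x \<in> simplices C (Suc m) \<Longrightarrow> Suc j < i \<Longrightarrow> i \<le> Suc (Suc m) \<Longrightarrow>
    face C (Suc (Suc m)) i (degen C (Suc m) j x) = degen C m j (face C (Suc m) (i - 1) x)"
  using simplicial_C[unfolded simplicial_set_def,
    THEN conjunct2, THEN conjunct2, THEN conjunct2, THEN conjunct2, THEN conjunct2, THEN conjunct2]
  by blast

lemma vertex_in: "i \<in> {1..n} \<Longrightarrow> v i \<in> simplices C 0"
  using is_circle unfolding is_circle_def nondegenerate_def by blast

lemma edge_in: "i \<in> {1..n} \<Longrightarrow> \<sigma> i \<in> simplices C 1"
  using is_circle unfolding is_circle_def nondegenerate_def by blast

lemma edge_faces:
  assumes "i \<in> {1..n}"
  shows "face C 1 1 (\<sigma> i) = v i" "face C 1 0 (\<sigma> i) = v (circle_next n i)"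
proof -
  have *: "face C 1 1 (\<sigma> i) = v i" if "i \<in> {1..n}" for i
    using is_circle that unfolding is_circle_def by blast
  show "face C 1 1 (\<sigma> i) = v i" using * assms .
  show "face C 1 0 (\<sigma> i) = v (circle_next n i)"
  proof (cases "i = n")
    case True
    then show ?thesis using is_circle *[of 1] n_pos by (simp add: is_circle_def circle_next_def)
  next
    case False
    then have "i \<in> {1..<n}" "Suc i \<in> {1..n}" using assms by auto
    then show ?thesis using is_circle *[of "Suc i"] False by (simp add: is_circle_def circle_next_def)
  qed
qed

lemma mem_M: "(i, k) \<in> simplices M m \<longleftrightarrow> i \<in> {1..n} \<and> k \<in> {1..Suc m}"
  by (simp add: circle_model_def)

lemma face_M_closed: "x \<in> simplices M (Suc m) \<Longrightarrow> j \<le> Suc m \<Longrightarrow> face M (Suc m) j x \<in> simplices M m"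
  using simplicial_set_circle_model[OF n_pos, unfolded simplicial_set_def, THEN conjunct1] by blast

lemma face_M: "face M m j (i, k) =
    (if j < k then (if k = 1 then (circle_next n i, m) else (i, k - 1)) else (i, k))"
  by (simp add: circle_model_def)

lemma degen_M: "degen M m j (i, k) = (if j < k then (i, Suc k) else (i, k))"
  by (simp add: circle_model_def)

lemma circle_simplex_in: "(i, k) \<in> simplices M m \<Longrightarrow> circle_simplex m (i, k) \<in> simplices C m"
proof (induction m arbitrary: k)
  case 0
  then show ?case by (simp add: vertex_in mem_M)
next
  case (Suc m)
  have "degen C m 0 (circle_simplex m (i, k - 1)) \<in> simplices C (Suc m)" if "1 < k"
    using Suc that by (intro degen_closed Suc.IH) (auto simp: mem_M)
  moreover have "degen C m m (circle_simplex m (i, 1)) \<in> simplices C (Suc m)"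
    using Suc by (intro degen_closed Suc.IH) (auto simp: mem_M)
  ultimately show ?case using edge_in[of i] Suc.prems by (auto simp: mem_M)
qed

text \<open>\<open>circle_simplex\<close> applies an outermost degeneracy: the one at 0 if the first
  block has length above 1, the last one otherwise. If \<open>j\<close> is that index the claim
  holds by construction; otherwise the degeneracy at \<open>j\<close> is commuted past it and the
  induction hypothesis applies one dimension lower.\<close>

lemma circle_simplex_degen:
  "(i, k) \<in> simplices M m \<Longrightarrow> j \<le> m \<Longrightarrow>
    degen C m j (circle_simplex m (i, k)) = circle_simplex (Suc m) (degen M m j (i, k))"
proof (induction m arbitrary: j k)
  case 0
  then show ?case by (simp add: mem_M degen_M)
next
  case (Suc m)
  note in_m = circle_simplex_in[of i _ m]
  consider "j = 0" | j' where "j = Suc j'" "1 < k" | j' where "j = Suc j'" "k = 1" "j' < m"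
    | "j = Suc m" "k = 1"
    using Suc.prems by (cases j) (auto simp: mem_M le_less)
  then show ?case
  proof cases
    case 1
    then show ?thesis using Suc.prems by (auto simp: mem_M degen_M)
  next
    case 2
    have k: "(i, k - 1) \<in> simplices M m" using Suc.prems 2 by (auto simp: mem_M)
    have "degen C (Suc m) j (circle_simplex (Suc m) (i, k)) =
        degen C (Suc m) 0 (degen C m j' (circle_simplex m (i, k - 1)))"
      using degen_degen[OF in_m[OF k], of 0 j'] Suc.prems 2 by simp
    also have "\<dots> = degen C (Suc m) 0 (circle_simplex (Suc m) (degen M m j' (i, k - 1)))"
      using Suc.IH[OF k, of j'] Suc.prems 2 by simp
    also have "\<dots> = circle_simplex (Suc (Suc m)) (degen M (Suc m) j (i, k))"
      using 2 by (simp add: degen_M del: circle_simplex.simps(2))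
        (simp add: circle_simplex.simps(2)[of "Suc m"] del: circle_simplex.simps(2); linarith)
    finally show ?thesis .
  next
    case 3
    have k: "(i, 1) \<in> simplices M m" using Suc.prems by (auto simp: mem_M)
    have "degen C (Suc m) j (circle_simplex (Suc m) (i, k)) =
        degen C (Suc m) (Suc j') (degen C m m (circle_simplex m (i, 1)))"
      using 3 by simp
    also have "\<dots> = degen C (Suc m) (Suc m) (degen C m (Suc j') (circle_simplex m (i, 1)))"
      using degen_degen[OF in_m[OF k], of "Suc j'" m] 3 by simp
    also have "\<dots> = degen C (Suc m) (Suc m) (circle_simplex (Suc m) (i, 1))"
      using Suc.IH[OF k, of "Suc j'"] 3 by (simp add: degen_M del: circle_simplex.simps(2))
    also have "\<dots> = circle_simplex (Suc (Suc m)) (degen M (Suc m) j (i, k))"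
      using 3 by (simp add: degen_M)
    finally show ?thesis .
  next
    case 4
    then show ?thesis by (simp add: degen_M)
  qed
qed

text \<open>A face either cancels against the outermost degeneracy or passes through it to a lower
  dimension. The gluing of consecutive edges enters only in the base case.\<close>

lemma circle_simplex_face:
  "(i, k) \<in> simplices M (Suc m) \<Longrightarrow> j \<le> Suc m \<Longrightarrow>
    face C (Suc m) j (circle_simplex (Suc m) (i, k)) = circle_simplex m (face M (Suc m) j (i, k))"
proof (induction m arbitrary: j k)
  case 0
  then have i: "i \<in> {1..n}" and jk: "j = 0 \<or> j = 1" "k = 1 \<or> k = 2" by (auto simp: mem_M)
  show ?case
  proof (cases "k = 1")
    case True
    then show ?thesis using edge_faces[OF i] jk by (auto simp: face_M)
  next
    case False
    then show ?thesis using face_degen_same[OF vertex_in[OF i], of 0] jk by (auto simp: face_M)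
  qed
next
  case (Suc m)
  note in_m = circle_simplex_in[of i _ "Suc m"]
  have i: "i \<in> {1..n}" using Suc.prems by (simp add: mem_M)
  have degen_eq: "degen C m l (circle_simplex m x) = circle_simplex (Suc m) (degen M m l x)"
    if "x \<in> simplices M m" "l \<le> m" for l x
    using that circle_simplex_degen by (cases x) simp
  show ?case
  proof (cases "1 < k")
    case True
    then have k: "(i, k - 1) \<in> simplices M (Suc m)" using Suc.prems by (auto simp: mem_M)
    have eq: "circle_simplex (Suc (Suc m)) (i, k) = degen C (Suc m) 0 (circle_simplex (Suc m) (i, k - 1))"
      using True by simp
    show ?thesis
    proof (cases "j \<le> 1")
      case True
      then have "face C (Suc (Suc m)) j (circle_simplex (Suc (Suc m)) (i, k)) = circle_simplex (Suc m) (i, k - 1)"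
        unfolding eq using face_degen_same[OF in_m[OF k], of 0] by (cases j) auto
      then show ?thesis using True \<open>1 < k\<close> by (simp add: face_M del: circle_simplex.simps)
    next
      case False
      then have "face C (Suc (Suc m)) j (circle_simplex (Suc (Suc m)) (i, k)) =
          degen C m 0 (face C (Suc m) (j - 1) (circle_simplex (Suc m) (i, k - 1)))"
        unfolding eq using face_degen_greater[OF in_m[OF k], of 0 j] Suc.prems by simp
      also have "\<dots> = degen C m 0 (circle_simplex m (face M (Suc m) (j - 1) (i, k - 1)))"
        using Suc.IH[OF k, of "j - 1"] Suc.prems False by simp
      also have "\<dots> = circle_simplex (Suc m) (degen M m 0 (face M (Suc m) (j - 1) (i, k - 1)))"
        using Suc.prems False by (intro degen_eq face_M_closed k) auto
      also have "degen M m 0 (face M (Suc m) (j - 1) (i, k - 1)) = face M (Suc (Suc m)) j (i, k)"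
        using False True by (auto simp: degen_M face_M)
      finally show ?thesis .
    qed
  next
    case False
    then have k: "k = 1" "(i, 1) \<in> simplices M (Suc m)" using Suc.prems by (auto simp: mem_M)
    have eq: "circle_simplex (Suc (Suc m)) (i, k) = degen C (Suc m) (Suc m) (circle_simplex (Suc m) (i, 1))"
      using False by simp
    show ?thesis
    proof (cases "j < Suc m")
      case True
      then have "face C (Suc (Suc m)) j (circle_simplex (Suc (Suc m)) (i, k)) =
          degen C m m (face C (Suc m) j (circle_simplex (Suc m) (i, 1)))"
        unfolding eq using face_degen_less[OF in_m[OF k(2)], of j "Suc m"] by simp
      also have "\<dots> = degen C m m (circle_simplex m (face M (Suc m) j (i, 1)))"
        using Suc.IH[OF k(2), of j] True by simp
      also have "\<dots> = circle_simplex (Suc m) (degen M m m (face M (Suc m) j (i, 1)))"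
        using True by (intro degen_eq face_M_closed k(2)) auto
      \<comment> \<open>For \<open>j = 0\<close> the face has left edge \<open>i\<close>, and both
        sides are the constant simplex at the start of edge \<open>circle_next n i\<close>.\<close>
      also have "degen M m m (face M (Suc m) j (i, 1)) = face M (Suc (Suc m)) j (i, k)"
        using True k(1) by (auto simp: degen_M face_M)
      finally show ?thesis .
    next
      case False
      then have "j = Suc m \<or> j = Suc (Suc m)" using Suc.prems by auto
      then have "face C (Suc (Suc m)) j (circle_simplex (Suc (Suc m)) (i, k)) = circle_simplex (Suc m) (i, 1)"
        unfolding eq using face_degen_same[OF in_m[OF k(2)], of "Suc m"] by auto
      then show ?thesis using False k by (simp add: face_M del: circle_simplex.simps)
    qed
  qed
qed

text \<open>A nondegenerate simplex is a listed vertex or edge; a degenerate one is reached by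
  induction, since the image is closed under degeneracies.\<close>

lemma circle_simplex_surj: "x \<in> simplices C m \<Longrightarrow> x \<in> circle_simplex m ` simplices M m"
proof (induction m arbitrary: x)
  case 0
  then have "x \<in> nondegenerate C 0" by (simp add: nondegenerate_def)
  then obtain i where "i \<in> {1..n}" "x = v i" using is_circle by (auto simp: is_circle_def)
  then show ?case by (intro image_eqI[of _ _ "(i, 1)"]) (auto simp: mem_M)
next
  case (Suc m)
  show ?case
  proof (cases "x \<in> nondegenerate C (Suc m)")
    case True
    have "m = 0"
    proof (rule ccontr)
      assume "m \<noteq> 0"
      then have "nondegenerate C (Suc m) = {}" using is_circle by (simp add: is_circle_def)
      then show False using True by simp
    qed
    then obtain i where "i \<in> {1..n}" "x = \<sigma> i" using is_circle True by (auto simp: is_circle_def)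
    then show ?thesis using \<open>m = 0\<close> by (intro image_eqI[of _ _ "(i, 1)"]) (auto simp: mem_M)
  next
    case False
    then obtain j y where jy: "x = degen C m j y" "j \<le> m" "y \<in> simplices C m"
      using Suc.prems by (auto simp: nondegenerate_def)
    obtain i k where ik: "y = circle_simplex m (i, k)" "(i, k) \<in> simplices M m" using Suc.IH[OF jy(3)] by auto
    have "x = circle_simplex (Suc m) (degen M m j (i, k))" using jy ik circle_simplex_degen by simp
    moreover have "degen M m j (i, k) \<in> simplices M (Suc m)" using ik(2) by (auto simp: mem_M degen_M)
    ultimately show ?thesis by blast
  qed
qed

text \<open>From dimension 2 on, the first and the last face determine the pair
  \<open>(i, k)\<close>. In dimension 1 faces are not enough: for \<open>n = 1\<close> the loop and
  the degenerate edge at its vertex have the same faces, so nondegeneracy of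
  \<open>\<sigma> i\<close> has to separate them.\<close>

lemma circle_simplex_inj:
  "(i, k) \<in> simplices M m \<Longrightarrow> (i', k') \<in> simplices M m \<Longrightarrow>
    circle_simplex m (i, k) = circle_simplex m (i', k') \<Longrightarrow> (i, k) = (i', k')"
proof (induction m arbitrary: i k i' k')
  case 0
  then have "i \<in> {1..n}" "i' \<in> {1..n}" "k = 1" "k' = 1" "v i = v i'" by (auto simp: mem_M)
  moreover have "inj_on v {1..n}" using is_circle by (simp add: is_circle_def)
  ultimately show ?case by (simp add: inj_on_eq_iff)
next
  case (Suc m)
  have faces: "face M (Suc m) j (i, k) = face M (Suc m) j (i', k')" if "j \<le> Suc m" for j
  proof -
    have "circle_simplex m (face M (Suc m) j (i, k)) = circle_simplex m (face M (Suc m) j (i', k'))"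
      using Suc.prems that circle_simplex_face by metis
    then show ?thesis
      using Suc.IH face_M_closed[OF Suc.prems(1) that] face_M_closed[OF Suc.prems(2) that]
      by (metis prod.collapse)
  qed
  show ?case
  proof (cases m)
    case 0
    have ks: "k \<in> {1, 2}" "k' \<in> {1, 2}" and ir: "i \<in> {1..n}" "i' \<in> {1..n}" using Suc.prems 0 by (auto simp: mem_M)
    have nd: "\<sigma> l \<noteq> degen C 0 0 y" if "l \<in> {1..n}" "y \<in> simplices C 0" for l y
    proof
      assume "\<sigma> l = degen C 0 0 y"
      moreover have "\<sigma> l \<in> nondegenerate C 1" using is_circle that by (auto simp: is_circle_def)
      ultimately show False using that unfolding nondegenerate_def by auto
    qed
    have inj: "inj_on \<sigma> {1..n}" using is_circle by (simp add: is_circle_def)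
    show ?thesis
    proof (cases "k = 1"; cases "k' = 1")
      assume "k = 1" "k' = 1"
      then show ?thesis using Suc.prems(3) 0 inj ir by (simp add: inj_on_eq_iff)
    next
      assume "k = 1" "k' \<noteq> 1"
      then show ?thesis using Suc.prems(3) 0 ks nd[OF ir(1) vertex_in[OF ir(2)]] by simp
    next
      assume "k \<noteq> 1" "k' = 1"
      then show ?thesis using Suc.prems(3) 0 ks nd[OF ir(2) vertex_in[OF ir(1)]] by simp
    next
      assume "k \<noteq> 1" "k' \<noteq> 1"
      then show ?thesis using faces[of 0] ks by (auto simp: face_M)
    qed
  next
    case (Suc l)
    then show ?thesis using faces[of 0] faces[of "Suc m"] Suc.prems
      by (auto simp: face_M mem_M split: if_splits)
  qed
qed

section \<open>Circulations correspond to simplicial distributions\<close>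

definition flow_of :: "(nat \<Rightarrow> 'a \<Rightarrow> nat list \<Rightarrow> real) \<Rightarrow> nat \<Rightarrow> nat \<Rightarrow> nat \<Rightarrow> real" where
  "flow_of p i a b = (if i < n then p 1 (\<sigma> (Suc i)) [a, b] else 0)"

text \<open>The only possible extension of the edge distributions to all dimensions: the model
  coordinates of \<open>x\<close> say along which map it is pulled back from an edge.\<close>

definition dist_of :: "(nat \<Rightarrow> nat \<Rightarrow> nat \<Rightarrow> real) \<Rightarrow> nat \<Rightarrow> 'a \<Rightarrow> nat list \<Rightarrow> real" where
  "dist_of P m = (\<lambda>x\<in>simplices C m.
     let (i, k) = inv_into (simplices M m) (circle_simplex m) x
     in push_forward (spread m k) (edge_dist P i))"

lemma circle_simplex_cases:
  assumes "x \<in> simplices C m"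
  obtains i k where "(i, k) \<in> simplices M m" "x = circle_simplex m (i, k)"
  using circle_simplex_surj[OF assms] by auto

lemma dist_of_circle_simplex:
  assumes "(i, k) \<in> simplices M m"
  shows "dist_of P m (circle_simplex m (i, k)) = push_forward (spread m k) (edge_dist P i)"
proof -
  have "inj_on (circle_simplex m) (simplices M m)"
    by (rule inj_onI) (metis circle_simplex_inj prod.collapse)
  then have "inv_into (simplices M m) (circle_simplex m) (circle_simplex m (i, k)) = (i, k)"
    using assms by (rule inv_into_f_f)
  then show ?thesis using circle_simplex_in[OF assms] by (simp add: dist_of_def)
qed

text \<open>Functoriality of push-forward reduces the simplicial identities to those for
  \<open>spread\<close>. Conservation of flow is called for by a single kind of face, the one that
  leaves its edge.\<close>

lemma dist_of_in_sDist:
  assumes P: "P \<in> flows n d"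
  shows "dist_of P \<in> sDist C (Delta (Z_mod d))"
proof -
  let ?Y = "Delta (Z_mod d)"
  have edge: "edge_dist P i \<in> dist_on (simplices ?Y 1)" if "(i, k) \<in> simplices M m" for i k m
    using edge_dist_in_dist_on[OF P] that by (simp add: mem_M)
  have maps: "dist_of P m \<in> simplices C m \<rightarrow>\<^sub>E dist_on (simplices ?Y m)" for m
  proof (rule PiE_I)
    fix x assume "x \<in> simplices C m"
    then obtain i k where ik: "(i, k) \<in> simplices M m" "x = circle_simplex m (i, k)"
      by (rule circle_simplex_cases)
    then have "spread m k \<in> simplices ?Y 1 \<rightarrow> simplices ?Y m" by (intro spread_in_Delta) (simp add: mem_M)
    then show "dist_of P m x \<in> dist_on (simplices ?Y m)"
      unfolding ik(2) dist_of_circle_simplex[OF ik(1)] by (rule push_forward_in_dist_on[OF edge[OF ik(1)]])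
  qed (simp add: dist_of_def)
  have faces: "dist_of P m (face C (Suc m) j x) = push_forward (face ?Y (Suc m) j) (dist_of P (Suc m) x)"
    if x: "x \<in> simplices C (Suc m)" and j: "j \<le> Suc m" for m j x
  proof -
    obtain i k where ik: "(i, k) \<in> simplices M (Suc m)" "x = circle_simplex (Suc m) (i, k)"
      using x by (rule circle_simplex_cases)
    then have i: "i \<in> {1..n}" and k: "1 \<le> k" "k \<le> Suc (Suc m)" by (auto simp: mem_M)
    have closed: "face M (Suc m) j (i, k) \<in> simplices M m" by (rule face_M_closed[OF ik(1) j])
    have "push_forward (face ?Y (Suc m) j) (dist_of P (Suc m) x) =
        push_forward (\<lambda>u. face ?Y (Suc m) j (spread (Suc m) k u)) (edge_dist P i)"
      unfolding ik(2) dist_of_circle_simplex[OF ik(1)] by (rule push_forward_comp[OF edge[OF ik(1)]])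
    also have "\<dots> = push_forward (spread m (if j < k then k - 1 else k)) (edge_dist P i)"
      by (simp only: face_spread[OF k(2) j])
    also have "\<dots> = dist_of P m (circle_simplex m (face M (Suc m) j (i, k)))"
    proof (cases "j < k \<and> k = 1")
      case False
      then have "face M (Suc m) j (i, k) = (i, if j < k then k - 1 else k)" by (auto simp: face_M)
      then show ?thesis using closed dist_of_circle_simplex by metis
    next
      case True
      let ?i = "circle_next n i"
      have next_in: "edge_dist P ?i \<in> dist_on (simplices ?Y 1)"
        by (rule edge_dist_in_dist_on[OF P circle_next_range[OF n_pos i]])
      have edge_i: "edge_dist P i \<in> dist_on (simplices ?Y 1)" by (rule edge[OF ik(1)])
      \<comment> \<open>Makes a constant \<open>m\<close>-simplex from a vertex. The constant
        simplex at the shared vertex arises from edge \<open>i\<close> as \<open>h\<close> after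
        face 0 and from the next edge as \<open>h\<close> after face 1, so agreement of the
        marginals suffices.\<close>
      define h where "h = (\<lambda>ys :: nat list. replicate (Suc m) (ys ! 0))"
      have "push_forward (spread m 0) (edge_dist P i) = push_forward (\<lambda>u. h (face ?Y 1 0 u)) (edge_dist P i)"
        by (rule push_forward_cong[OF edge_i])
          (auto simp: mem_Delta_1 spread_def h_def face_Delta_pair simp del: One_nat_def)
      also have "\<dots> = push_forward h (push_forward (face ?Y 1 0) (edge_dist P i))"
        by (rule push_forward_comp[OF edge_i, symmetric])
      also have "\<dots> = push_forward h (push_forward (face ?Y 1 1) (edge_dist P ?i))"
        by (simp only: edge_dist_compatible[OF P i])
      also have "\<dots> = push_forward (\<lambda>u. h (face ?Y 1 1 u)) (edge_dist P ?i)"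
        by (rule push_forward_comp[OF next_in])
      also have "\<dots> = push_forward (spread m (Suc m)) (edge_dist P ?i)"
        by (rule push_forward_cong[OF next_in])
          (auto simp: mem_Delta_1 spread_def h_def face_Delta_pair simp del: One_nat_def)
      finally have *: "push_forward (spread m 0) (edge_dist P i) = push_forward (spread m (Suc m)) (edge_dist P ?i)" .
      have "face M (Suc m) j (i, k) = (?i, Suc m)" using True by (simp add: face_M)
      then show ?thesis using closed dist_of_circle_simplex True * by simp
    qed
    also have "\<dots> = dist_of P m (face C (Suc m) j x)"
      using circle_simplex_face[OF ik(1) j] ik(2) by simp
    finally show ?thesis by simp
  qed
  have degens: "dist_of P (Suc m) (degen C m j x) = push_forward (degen ?Y m j) (dist_of P m x)"
    if x: "x \<in> simplices C m" and j: "j \<le> m" for m j x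
  proof -
    obtain i k where ik: "(i, k) \<in> simplices M m" "x = circle_simplex m (i, k)"
      using x by (rule circle_simplex_cases)
    then have k: "k \<le> Suc m" by (simp add: mem_M)
    have "push_forward (degen ?Y m j) (dist_of P m x) =
        push_forward (\<lambda>u. degen ?Y m j (spread m k u)) (edge_dist P i)"
      unfolding ik(2) dist_of_circle_simplex[OF ik(1)] by (rule push_forward_comp[OF edge[OF ik(1)]])
    also have "\<dots> = push_forward (spread (Suc m) (if j < k then Suc k else k)) (edge_dist P i)"
      by (simp only: degen_spread[OF k j])
    also have "\<dots> = dist_of P (Suc m) (circle_simplex (Suc m) (i, if j < k then Suc k else k))"
      by (rule dist_of_circle_simplex[symmetric]) (use ik(1) in \<open>auto simp: mem_M\<close>)
    also have "(i, if j < k then Suc k else k) = degen M m j (i, k)" by (simp add: degen_M)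
    also have "circle_simplex (Suc m) (degen M m j (i, k)) = degen C m j x"
      using circle_simplex_degen[OF ik(1) j] ik(2) by simp
    finally show ?thesis by simp
  qed
  show ?thesis
    unfolding sDist_def simplicial_maps_def dist_sset_def using maps faces degens by simp
qed

lemma sDist_maps:
  assumes "p \<in> sDist C Y"
  shows "p m \<in> simplices C m \<rightarrow>\<^sub>E dist_on (simplices Y m)"
    and "x \<in> simplices C (Suc m) \<Longrightarrow> j \<le> Suc m \<Longrightarrow>
      p m (face C (Suc m) j x) = push_forward (face Y (Suc m) j) (p (Suc m) x)"
    and "x \<in> simplices C m \<Longrightarrow> j \<le> m \<Longrightarrow>
      p (Suc m) (degen C m j x) = push_forward (degen Y m j) (p m x)"
  using assms unfolding sDist_def simplicial_maps_def dist_sset_def by simp_all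

lemma sDist_edge:
  "p \<in> sDist C Y \<Longrightarrow> i \<in> {1..n} \<Longrightarrow> p 1 (\<sigma> i) \<in> dist_on (simplices Y 1)"
  using sDist_maps(1)[of p Y 1] edge_in by (auto simp: PiE_def Pi_def)

lemma edge_dist_flow_of:
  assumes p: "p \<in> sDist C (Delta (Z_mod d))" and i: "i \<in> {1..n}"
  shows "edge_dist (flow_of p) i = p 1 (\<sigma> i)"
proof
  fix xs
  show "edge_dist (flow_of p) i xs = p 1 (\<sigma> i) xs"
  proof (cases "length xs = 2")
    case True
    then obtain a b where "xs = [a, b]" by (auto simp: length_Suc_conv numeral_2_eq_2)
    then show ?thesis using i by (auto simp: flow_of_def)
  next
    case False
    then have "xs \<notin> simplices (Delta (Z_mod d)) 1" unfolding mem_Delta_1 by auto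
    then show ?thesis using sDist_edge[OF p i] False by (simp add: edge_dist_def dist_on_def)
  qed
qed

lemma flow_of_in_flows:
  assumes p: "p \<in> sDist C (Delta (Z_mod d))"
  shows "flow_of p \<in> flows n d"
proof -
  let ?Y = "Delta (Z_mod d)"
  have flow: "flow_of p i a b = p 1 (\<sigma> (Suc i)) [a, b]" if "i < n" for i a b
    using that by (simp add: flow_of_def)
  have edge: "p 1 (\<sigma> (Suc i)) \<in> dist_on (simplices ?Y 1)" if "i < n" for i
    using sDist_edge[OF p, of "Suc i"] that by simp
  note edge' = edge[unfolded dist_on_Delta_1]
  have "0 \<le> flow_of p i a b" for i a b using edge'[of i] by (simp add: flow_of_def)
  moreover have "flow_of p i a b = 0" if "\<not> (i < n \<and> a < d \<and> b < d)" for i a b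
  proof (cases "i < n")
    case True
    then have "[a, b] \<notin> simplices ?Y 1" using that unfolding mem_Delta_1 by simp
    then have "p 1 (\<sigma> (Suc i)) [a, b] = 0" using edge'[OF True] by blast
    then show ?thesis using flow[OF True] by simp
  qed (simp add: flow_of_def)
  moreover have "(\<Sum>a<d. \<Sum>b<d. flow_of p i a b) = 1" if "i < n" for i
    using edge'[OF that] that by (simp add: flow_of_def)
  moreover have "(\<Sum>a<d. flow_of p i a b) = (\<Sum>c<d. flow_of p (Suc i mod n) b c)"
    if i: "i < n" and b: "b < d" for i b
  proof -
    have i1: "Suc i \<in> {1..n}" using i by simp
    have i': "Suc i mod n < n" using n_pos by simp
    have next_i: "circle_next n (Suc i) = Suc (Suc i mod n)" using i by (auto simp: circle_next_def)
    \<comment> \<open>Both marginals equal the value of \<open>p\<close> at the vertex shared by the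
      two edges.\<close>
    have "push_forward (face ?Y 1 0) (p 1 (\<sigma> (Suc i))) = p 0 (face C 1 0 (\<sigma> (Suc i)))"
      using sDist_maps(2)[OF p, of "\<sigma> (Suc i)" 0 0] edge_in[OF i1] by simp
    also have "\<dots> = p 0 (face C 1 1 (\<sigma> (Suc (Suc i mod n))))"
      using edge_faces(2)[OF i1] edge_faces(1)[of "Suc (Suc i mod n)"] i' next_i by simp
    also have "\<dots> = push_forward (face ?Y 1 1) (p 1 (\<sigma> (Suc (Suc i mod n))))"
      using sDist_maps(2)[OF p, of "\<sigma> (Suc (Suc i mod n))" 0 1] edge_in[of "Suc (Suc i mod n)"] i' by simp
    finally show ?thesis
      unfolding push_forward_face_eq_iff[OF edge[OF i] edge[OF i']] using b flow[OF i] flow[OF i'] by simp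
  qed
  ultimately show ?thesis unfolding flows_def by blast
qed

text \<open>Every simplex is built from an edge by degeneracies, or is a vertex and then the face 1
  of the edge starting there, so compatibility of \<open>p\<close> leaves no freedom beyond the
  edges.\<close>

lemma sDist_circle_simplex:
  assumes p: "p \<in> sDist C (Delta (Z_mod d))"
  shows "(i, k) \<in> simplices M m \<Longrightarrow>
    p m (circle_simplex m (i, k)) = push_forward (spread m k) (p 1 (\<sigma> i))"
proof (induction m arbitrary: k)
  let ?Y = "Delta (Z_mod d)"
  case 0
  then have i: "i \<in> {1..n}" and k: "k = 1" by (auto simp: mem_M)
  have spread_0_1: "spread 0 1 [a, b] = [a]" for a b by (simp add: spread_def)
  have "p 0 (v i) = push_forward (face ?Y 1 1) (p 1 (\<sigma> i))"
    using sDist_maps(2)[OF p, of "\<sigma> i" 0 1] edge_in[OF i] edge_faces(1)[OF i] by simp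
  also have "\<dots> = push_forward (spread 0 1) (p 1 (\<sigma> i))"
    by (rule push_forward_cong[OF sDist_edge[OF p i]])
      (auto simp: mem_Delta_1 spread_0_1 face_Delta_pair simp del: One_nat_def)
  finally show ?case using k by simp
next
  let ?Y = "Delta (Z_mod d)"
  case (Suc m)
  then have i: "i \<in> {1..n}" and k: "1 \<le> k" "k \<le> Suc (Suc m)" by (auto simp: mem_M)
  have step: "p (Suc m) (degen C m j (circle_simplex m (i, l))) =
      push_forward (spread (Suc m) (if j < l then Suc l else l)) (p 1 (\<sigma> i))"
    if l: "(i, l) \<in> simplices M m" and j: "j \<le> m" for j l
  proof -
    have lm: "l \<le> Suc m" using l by (simp add: mem_M)
    have "p (Suc m) (degen C m j (circle_simplex m (i, l))) =
        push_forward (degen ?Y m j) (push_forward (spread m l) (p 1 (\<sigma> i)))"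
      using sDist_maps(3)[OF p circle_simplex_in[OF l] j] Suc.IH[OF l] by simp
    also have "\<dots> = push_forward (\<lambda>u. degen ?Y m j (spread m l u)) (p 1 (\<sigma> i))"
      by (rule push_forward_comp[OF sDist_edge[OF p i]])
    finally show ?thesis by (simp only: degen_spread[OF lm j])
  qed
  consider "1 < k" | "k = 1" "m = 0" | "k = 1" "0 < m" using k by linarith
  then show ?case
  proof cases
    case 1
    then have "(i, k - 1) \<in> simplices M m" using Suc.prems by (auto simp: mem_M)
    then show ?thesis using step[of "k - 1" 0] 1 by simp
  next
    case 2
    have "push_forward (spread 1 1) (p 1 (\<sigma> i)) = p 1 (\<sigma> i)"
      by (rule push_forward_id[OF sDist_edge[OF p i]]) (rule spread_1_1)
    then show ?thesis using 2 by simp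
  next
    case 3
    then have "(i, 1) \<in> simplices M m" using Suc.prems by (auto simp: mem_M)
    then show ?thesis using step[of 1 m] 3 by simp
  qed
qed

lemma dist_of_flow_of:
  assumes p: "p \<in> sDist C (Delta (Z_mod d))"
  shows "dist_of (flow_of p) = p"
proof (intro ext)
  fix m x y
  show "dist_of (flow_of p) m x y = p m x y"
  proof (cases "x \<in> simplices C m")
    case True
    then obtain i k where ik: "(i, k) \<in> simplices M m" "x = circle_simplex m (i, k)"
      by (rule circle_simplex_cases)
    then have "i \<in> {1..n}" by (simp add: mem_M)
    then show ?thesis
      using ik sDist_circle_simplex[OF p ik(1)] dist_of_circle_simplex[OF ik(1)] edge_dist_flow_of[OF p] by simp
  next
    case False
    then show ?thesis using sDist_maps(1)[OF p, of m] by (simp add: dist_of_def PiE_def extensional_def)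
  qed
qed

lemma flow_of_dist_of:
  assumes P: "P \<in> flows n d"
  shows "flow_of (dist_of P) = P"
proof (intro ext)
  fix i a b
  show "flow_of (dist_of P) i a b = P i a b"
  proof (cases "i < n")
    case True
    then have i: "Suc i \<in> {1..n}" by simp
    have "dist_of P 1 (\<sigma> (Suc i)) = push_forward (spread 1 1) (edge_dist P (Suc i))"
      using dist_of_circle_simplex[of "Suc i" 1 1 P] i by (simp add: mem_M)
    also have "\<dots> = edge_dist P (Suc i)"
      by (rule push_forward_id[OF edge_dist_in_dist_on[OF P i]]) (rule spread_1_1)
    finally show ?thesis using True by (simp add: flow_of_def)
  next
    case False
    then show ?thesis using P by (simp add: flow_of_def flows_def)
  qed
qed

lemma bij_betw_flow_of: "bij_betw flow_of (sDist C (Delta (Z_mod d))) (flows n d)"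
  by (rule bij_betw_byWitness[where f' = dist_of])
    (auto simp: dist_of_flow_of flow_of_dist_of flow_of_in_flows dist_of_in_sDist)

section \<open>Convex combinations and vertices\<close>

lemma flow_of_convex_comb:
  "flow_of (convex_comb C \<alpha> q r) = (\<lambda>i a b. \<alpha> * flow_of q i a b + (1 - \<alpha>) * flow_of r i a b)"
proof (intro ext)
  fix i a b
  show "flow_of (convex_comb C \<alpha> q r) i a b = \<alpha> * flow_of q i a b + (1 - \<alpha>) * flow_of r i a b"
    using edge_in[of "Suc i"] by (simp add: flow_of_def convex_comb_def)
qed

lemma dist_of_convex_comb:
  assumes P: "P \<in> flows n d" and Q: "Q \<in> flows n d" and R: "R \<in> flows n d"
    and eq: "P = (\<lambda>i a b. \<alpha> * Q i a b + (1 - \<alpha>) * R i a b)"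
  shows "dist_of P = convex_comb C \<alpha> (dist_of Q) (dist_of R)"
proof (intro ext)
  fix m x y
  show "dist_of P m x y = convex_comb C \<alpha> (dist_of Q) (dist_of R) m x y"
  proof (cases "x \<in> simplices C m")
    case True
    then obtain i k where ik: "(i, k) \<in> simplices M m" "x = circle_simplex m (i, k)"
      by (rule circle_simplex_cases)
    then have i: "i \<in> {1..n}" by (simp add: mem_M)
    have "dist_of S m x y = (\<Sum>a<d. \<Sum>b<d. if spread m k [a, b] = y then S (i - 1) a b else 0)"
      if "S \<in> flows n d" for S
      unfolding ik(2) dist_of_circle_simplex[OF ik(1)]
        push_forward_Delta_1[OF edge_dist_in_dist_on[OF that i]] edge_dist_pair ..
    then show ?thesis
      using True P Q R
      by (simp add: convex_comb_def eq sum_distrib_left if_distrib cong: if_cong flip: sum.distrib)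
  qed (simp add: dist_of_def convex_comb_def)
qed

text \<open>Extremality refers only to the convex structure, and \<open>flow_of\<close> and its
  inverse \<open>dist_of\<close> both respect convex combinations, so a decomposition on either side
  carries over to the other.\<close>

lemma bij_betw_flow_of_vertices:
  "bij_betw flow_of (sDist_vertices C (Delta (Z_mod d))) (extremal_flows n d)"
proof -
  let ?Y = "Delta (Z_mod d)"
  have extremal: "flow_of p \<in> extremal_flows n d" if p: "p \<in> sDist_vertices C ?Y" for p
  proof -
    have pS: "p \<in> sDist C ?Y" using p by (simp add: sDist_vertices_def)
    have "flow_of p = Q"
      if "Q \<in> flows n d" "R \<in> flows n d" "0 < \<alpha>" "\<alpha> \<le> 1"
        "flow_of p = (\<lambda>i a b. \<alpha> * Q i a b + (1 - \<alpha>) * R i a b)" for Q R \<alpha>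
    proof -
      have "p = convex_comb C \<alpha> (dist_of Q) (dist_of R)"
        using dist_of_convex_comb[OF flow_of_in_flows[OF pS] that(1,2,5)] dist_of_flow_of[OF pS] by simp
      then have "p = dist_of Q"
        using p dist_of_in_sDist[OF that(1)] dist_of_in_sDist[OF that(2)] that(3,4)
        unfolding sDist_vertices_def by blast
      then show ?thesis using flow_of_dist_of[OF that(1)] by simp
    qed
    then show ?thesis using flow_of_in_flows[OF pS] unfolding extremal_flows_def by blast
  qed
  have vertex: "p \<in> sDist_vertices C ?Y" if pS: "p \<in> sDist C ?Y" and p: "flow_of p \<in> extremal_flows n d" for p
  proof -
    have "p = q"
      if "q \<in> sDist C ?Y" "r \<in> sDist C ?Y" "0 < \<alpha>" "\<alpha> \<le> 1" "p = convex_comb C \<alpha> q r" for q r \<alpha>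
    proof -
      have "flow_of p = (\<lambda>i a b. \<alpha> * flow_of q i a b + (1 - \<alpha>) * flow_of r i a b)"
        unfolding that(5) by (rule flow_of_convex_comb)
      then have "flow_of p = flow_of q"
        using p flow_of_in_flows[OF that(1)] flow_of_in_flows[OF that(2)] that(3,4)
        unfolding extremal_flows_def by blast
      then show ?thesis using dist_of_flow_of pS that(1) by metis
    qed
    then show ?thesis using pS unfolding sDist_vertices_def by blast
  qed
  have "flow_of ` sDist_vertices C ?Y = extremal_flows n d"
  proof (intro equalityI subsetI)
    fix P assume P: "P \<in> extremal_flows n d"
    then have "P \<in> flows n d" by (simp add: extremal_flows_def)
    then have "flow_of (dist_of P) = P" "dist_of P \<in> sDist C ?Y"
      by (rule flow_of_dist_of, rule dist_of_in_sDist)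
    then show "P \<in> flow_of ` sDist_vertices C ?Y" using vertex P by (metis imageI)
  qed (use extremal in blast)
  moreover have "sDist_vertices C ?Y \<subseteq> sDist C ?Y" by (auto simp: sDist_vertices_def)
  ultimately show ?thesis using bij_betw_flow_of[of d] by (metis bij_betw_subset)
qed

end

theorem corollary4p5:
  fixes n d :: nat and C :: "'a sset" and \<sigma> v :: "nat \<Rightarrow> 'a"
  assumes "n \<ge> 1" and "d \<ge> 1" and "is_circle n C \<sigma> v"
  shows "card (sDist_vertices C (Delta (Z_mod d))) =
    (\<Sum>k = 1..d. (d choose k) ^ n * fact k ^ (n - 1) * fact (k - 1))"
proof -
  interpret directed_circle n C \<sigma> v using assms by unfold_locales
  show ?thesis
    using bij_betw_same_card[OF bij_betw_flow_of_vertices[of d]] card_extremal_flows[of n d] assms(1) by simp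
qed

end
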